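(* There exists a positive constant $C$ such that $\mathfrak{h}_\alpha\ge C(1-\alpha)^{-1/2}$ for all $\alpha\in(0,1)$, where $$ \mathfrak{h}_\alpha:=\sup\big\{\|f\|_{\mathrm{O}\Lambda_\alpha}:\ f\in\Lambda_\alpha(\mathbb{R}^2),\ \|f\|_{\Lambda_\alpha}\le1\big\}. $$
   Context: $\mathbb{C}$ is identified with $\mathbb{R}^2$. For $0<\alpha<1$, $\Lambda_\alpha(\mathbb{R}^2)$ is the class of functions $f:\mathbb{C}\to\mathbb{C}$ with $\|f\|_{\Lambda_\alpha}:=\sup_{\zeta_1\ne\zeta_2}\frac{|f(\zeta_1)-f(\zeta_2)|}{|\zeta_1-\zeta_2|^\alpha}<\infty$. The operator Hölder seminorm is $\|f\|_{\mathrm{O}\Lambda_\alpha}:=\sup\frac{\|f(N_1)-f(N_2)\|}{\|N_1-N_2\|^\alpha}$, where the supremum is over all pairs $N_1\neq N_2$ of bounded normal operators acting on the same complex separable (possibly infinite-dimensional) Hilbert space, over all such spaces. *)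

theory Defs
  imports
    "HOL-Algebra.Module"
    "HOL-Analysis.Analysis"
begin

section \<open>Separable complex Hilbert spaces\<close>

text \<open>
  A Hilbert space is an explicit structure (carrier set with operations) rather than a type class,
  because the operator Hoelder seminorm is a supremum over all Hilbert spaces. The vector space
  part is the library's notion of a module, taken over the ring of complex numbers; the fields
  mult and one that the record of modules inherits from rings are not used. The inner product is
  linear in its first argument.
\<close>

definition complex_ring :: "complex ring" where
  "complex_ring = \<lparr>carrier = UNIV, monoid.mult = (*), one = 1, zero = 0, add = (+)\<rparr>"

record 'v hilbert = "(complex, 'v) module" +
  ip :: "'v \<Rightarrow> 'v \<Rightarrow> complex"

definition hnorm :: "'v hilbert \<Rightarrow> 'v \<Rightarrow> real" where
  "hnorm H x = sqrt (Re (ip H x x))"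

locale separable_hilbert_space =
  Module.module complex_ring H
  for H :: "'v hilbert" (structure) +
  assumes ip_add_left:
      "\<lbrakk>x \<in> carrier H; y \<in> carrier H; z \<in> carrier H\<rbrakk> \<Longrightarrow> ip H (x \<oplus> y) z = ip H x z + ip H y z"
    and ip_scale_left:
      "\<lbrakk>x \<in> carrier H; y \<in> carrier H\<rbrakk> \<Longrightarrow> ip H (c \<odot> x) y = c * ip H x y"
    and ip_commute:
      "\<lbrakk>x \<in> carrier H; y \<in> carrier H\<rbrakk> \<Longrightarrow> ip H y x = cnj (ip H x y)"
    and ip_pos:
      "\<lbrakk>x \<in> carrier H; x \<noteq> \<zero>\<rbrakk> \<Longrightarrow> 0 < Re (ip H x x)"
    and complete:
      "\<lbrakk>\<And>n. u n \<in> carrier H;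
        \<And>e. 0 < e \<Longrightarrow> \<exists>M. \<forall>m\<ge>M. \<forall>n\<ge>M. hnorm H (u m \<ominus> u n) < e\<rbrakk>
        \<Longrightarrow> \<exists>x\<in>carrier H. (\<lambda>n. hnorm H (u n \<ominus> x)) \<longlonglongrightarrow> 0"
    and separable:
      "\<exists>D\<subseteq>carrier H. countable D \<and> (\<forall>x\<in>carrier H. \<forall>e>0. \<exists>d\<in>D. hnorm H (x \<ominus> d) < e)"


section \<open>Bounded operators\<close>

text \<open>
  Operators are extensional functions on the carrier, so that equality of operators is equality
  in HOL. Their product is the library's operation compose.
\<close>

definition bounded_ops :: "'v hilbert \<Rightarrow> ('v \<Rightarrow> 'v) set" where
  "bounded_ops H = {T \<in> carrier H \<rightarrow>\<^sub>E carrier H.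
     (\<forall>x\<in>carrier H. \<forall>y\<in>carrier H. T (x \<oplus>\<^bsub>H\<^esub> y) = T x \<oplus>\<^bsub>H\<^esub> T y) \<and>
     (\<forall>c. \<forall>x\<in>carrier H. T (c \<odot>\<^bsub>H\<^esub> x) = c \<odot>\<^bsub>H\<^esub> T x) \<and>
     (\<exists>K. \<forall>x\<in>carrier H. hnorm H (T x) \<le> K * hnorm H x)}"

definition op_norm :: "'v hilbert \<Rightarrow> ('v \<Rightarrow> 'v) \<Rightarrow> real" where
  "op_norm H T = (SUP x\<in>{x \<in> carrier H. hnorm H x \<le> 1}. hnorm H (T x))"

definition op_id :: "'v hilbert \<Rightarrow> 'v \<Rightarrow> 'v" where
  "op_id H = (\<lambda>x\<in>carrier H. x)"

definition op_add :: "'v hilbert \<Rightarrow> ('v \<Rightarrow> 'v) \<Rightarrow> ('v \<Rightarrow> 'v) \<Rightarrow> 'v \<Rightarrow> 'v" where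
  "op_add H S T = (\<lambda>x\<in>carrier H. S x \<oplus>\<^bsub>H\<^esub> T x)"

definition op_diff :: "'v hilbert \<Rightarrow> ('v \<Rightarrow> 'v) \<Rightarrow> ('v \<Rightarrow> 'v) \<Rightarrow> 'v \<Rightarrow> 'v" where
  "op_diff H S T = (\<lambda>x\<in>carrier H. S x \<ominus>\<^bsub>H\<^esub> T x)"

definition op_scale :: "'v hilbert \<Rightarrow> complex \<Rightarrow> ('v \<Rightarrow> 'v) \<Rightarrow> 'v \<Rightarrow> 'v" where
  "op_scale H c T = (\<lambda>x\<in>carrier H. c \<odot>\<^bsub>H\<^esub> T x)"

definition op_adjoint :: "'v hilbert \<Rightarrow> ('v \<Rightarrow> 'v) \<Rightarrow> 'v \<Rightarrow> 'v" where
  "op_adjoint H T = (THE S. S \<in> bounded_ops H \<and>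
     (\<forall>x\<in>carrier H. \<forall>y\<in>carrier H. ip H (T x) y = ip H x (S y)))"

definition normal_ops :: "'v hilbert \<Rightarrow> ('v \<Rightarrow> 'v) set" where
  "normal_ops H = {N \<in> bounded_ops H.
     compose (carrier H) N (op_adjoint H N) = compose (carrier H) (op_adjoint H N) N}"

definition op_spectrum :: "'v hilbert \<Rightarrow> ('v \<Rightarrow> 'v) \<Rightarrow> complex set" where
  "op_spectrum H T = {c. \<not> (\<exists>S\<in>bounded_ops H.
     compose (carrier H) S (op_diff H T (op_scale H c (op_id H))) = op_id H \<and>
     compose (carrier H) (op_diff H T (op_scale H c (op_id H))) S = op_id H)}"


section \<open>Continuous functional calculus of a normal operator\<close>

text \<open>
  The maps \<open>F\<close> singled out below are the unital star-homomorphisms from the continuous functions on the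
  spectrum of \<open>N\<close> to the bounded operators that send the identity function to \<open>N\<close>. An element of the
  domain is represented by any function on the plane whose restriction to the spectrum is the
  given one. Such a homomorphism is automatically contractive, hence by Stone-Weierstrass it is
  unique; it exists for every bounded normal \<open>N\<close>.
\<close>

definition functional_calculus ::
    "'v hilbert \<Rightarrow> ('v \<Rightarrow> 'v) \<Rightarrow> ((complex \<Rightarrow> complex) \<Rightarrow> 'v \<Rightarrow> 'v) \<Rightarrow> bool" where
  "functional_calculus H N F \<longleftrightarrow>
     (\<forall>f. continuous_on (op_spectrum H N) f \<longrightarrow>
        F f \<in> bounded_ops H \<and>
        F (\<lambda>z. cnj (f z)) = op_adjoint H (F f) \<and>
        (\<forall>c. F (\<lambda>z. c * f z) = op_scale H c (F f)) \<and>
        (\<forall>g. continuous_on (op_spectrum H N) g \<longrightarrow>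
           ((\<forall>z\<in>op_spectrum H N. f z = g z) \<longrightarrow> F f = F g) \<and>
           F (\<lambda>z. f z + g z) = op_add H (F f) (F g) \<and>
           F (\<lambda>z. f z * g z) = compose (carrier H) (F f) (F g))) \<and>
     F (\<lambda>z. 1) = op_id H \<and>
     F (\<lambda>z. z) = N"

definition op_apply :: "'v hilbert \<Rightarrow> (complex \<Rightarrow> complex) \<Rightarrow> ('v \<Rightarrow> 'v) \<Rightarrow> 'v \<Rightarrow> 'v" where
  "op_apply H f N = (THE T. \<exists>F. functional_calculus H N F \<and> T = F f)"


section \<open>Hoelder and operator Hoelder seminorms\<close>

definition holder_seminorm :: "real \<Rightarrow> (complex \<Rightarrow> complex) \<Rightarrow> ennreal" where
  "holder_seminorm \<alpha> f =
     (SUP (z, w)\<in>{(z, w). z \<noteq> w}. ennreal (cmod (f z - f w) / cmod (z - w) powr \<alpha>))"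

definition holder_class :: "real \<Rightarrow> (complex \<Rightarrow> complex) set" where
  "holder_class \<alpha> = {f. holder_seminorm \<alpha> f < \<infinity>}"

text \<open>
  The supremum over all separable Hilbert spaces is taken over all Hilbert space structures whose
  carrier is a subset of the type of complex sequences. This loses nothing: every separable
  Hilbert space is isometrically isomorphic to \<open>l\<^sup>2\<close> or to a finite-dimensional coordinate
  space, both of which have such a carrier, and the quotients below are unitarily invariant.
\<close>

definition op_holder_seminorm :: "real \<Rightarrow> (complex \<Rightarrow> complex) \<Rightarrow> ennreal" where
  "op_holder_seminorm \<alpha> f =
     (SUP (H, N1, N2)\<in>{(H :: (nat \<Rightarrow> complex) hilbert, N1, N2).
         separable_hilbert_space H \<and> N1 \<in> normal_ops H \<and> N2 \<in> normal_ops H \<and> N1 \<noteq> N2}.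
       ennreal (op_norm H (op_diff H (op_apply H f N1) (op_apply H f N2))
         / op_norm H (op_diff H N1 N2) powr \<alpha>))"

definition op_holder_const :: "real \<Rightarrow> ennreal" where
  "op_holder_const \<alpha> =
     (SUP f\<in>{f \<in> holder_class \<alpha>. holder_seminorm \<alpha> f \<le> 1}. op_holder_seminorm \<alpha> f)"

end

theory Submission
  imports Defs "Jordan_Normal_Form.Determinant"
begin

text \<open>
  Already self-adjoint operators with finite spectrum suffice. Let \<open>x < 2\<^sup>L\<close> have binary digits \<open>x\<^sub>1, \<dots>, x\<^sub>L\<close>,
  least significant first, and put \<open>\<lambda>(x) = \<Sum> x\<^sub>s / 4^s\<close> and \<open>\<phi>(x) = - \<Sum> (-1)^s x\<^sub>s / 4^s\<close>. If \<open>x\<close> and \<open>y\<close>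
  first differ at digit \<open>s\<close>, then \<open>(\<phi>(x) - \<phi>(y)) / (\<lambda>(x) - \<lambda>(y))\<close> has sign \<open>- (-1)^s\<close> and modulus in
  \<open>[1/2, 2]\<close>. The kernel \<open>B\<close> whose entry at such a pair is \<open>- (-1)^s 2^(s-1) / 2^L\<close> is a contraction, because
  it acts separately on means and on fluctuations over residue classes modulo powers of 2. Each row of
  \<open>\<bar>B\<bar>\<close>, however, sums to \<open>L / 2\<close>, and multiplying \<open>B\<close> entrywise by the divided differences aligns
  all signs, which makes its norm of order \<open>L\<close>.

  Solving \<open>[\<lambda>, R] = t B\<close> gives a skew-hermitian \<open>R\<close> with \<open>\<parallel>[\<phi>, R]\<parallel> \<ge> c t L\<close>, and conjugation by the Cayley
  transform of \<open>R\<close> turns commutators into differences of unitarily equivalent operators. With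
  \<open>t = 1 / 16^L\<close> and \<open>L\<close> the integer part of \<open>1 / (1 - \<alpha>)\<close>, the factor \<open>t powr (1 - \<alpha>)\<close> stays away
  from 0, so the Hoelder quotient is at least \<open>c L\<close>. This even yields the bound \<open>c / (1 - \<alpha>)\<close>.
\<close>

section \<open>Coordinate Hilbert spaces\<close>

text \<open>Vectors of C^n are sequences that vanish from \<open>n\<close> on, so the carrier lies
  in the type over which \<open>op_holder_seminorm\<close> takes its supremum.\<close>

definition cvec :: "nat \<Rightarrow> (nat \<Rightarrow> complex) set" where
  "cvec n = {x. \<forall>i\<ge>n. x i = 0}"

definition cinner :: "nat \<Rightarrow> (nat \<Rightarrow> complex) \<Rightarrow> (nat \<Rightarrow> complex) \<Rightarrow> complex" where
  "cinner n x y = (\<Sum>i<n. x i * cnj (y i))"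

definition cnorm :: "nat \<Rightarrow> (nat \<Rightarrow> complex) \<Rightarrow> real" where
  "cnorm n x = L2_set (\<lambda>i. cmod (x i)) {..<n}"

definition cspace :: "nat \<Rightarrow> (nat \<Rightarrow> complex) hilbert" where
  "cspace n = \<lparr>carrier = cvec n, monoid.mult = (\<lambda>x y. x), one = (\<lambda>i. 0), ring.zero = (\<lambda>i. 0),
     ring.add = (\<lambda>x y i. x i + y i), module.smult = (\<lambda>c x i. c * x i), ip = cinner n\<rparr>"

lemma cspace_simps [simp]:
  "carrier (cspace n) = cvec n"
  "ring.zero (cspace n) = (\<lambda>i. 0)"
  "ring.add (cspace n) x y = (\<lambda>i. x i + y i)"
  "module.smult (cspace n) c x = (\<lambda>i. c * x i)"
  "ip (cspace n) = cinner n"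
  by (simp_all add: cspace_def)

lemma cvec_closed [simp, intro]:
  "(\<lambda>i. 0) \<in> cvec n"
  "x \<in> cvec n \<Longrightarrow> y \<in> cvec n \<Longrightarrow> (\<lambda>i. x i + y i) \<in> cvec n"
  "x \<in> cvec n \<Longrightarrow> y \<in> cvec n \<Longrightarrow> (\<lambda>i. x i - y i) \<in> cvec n"
  "x \<in> cvec n \<Longrightarrow> (\<lambda>i. e i * x i) \<in> cvec n"
  "x \<in> cvec n \<Longrightarrow> (\<lambda>i. - x i) \<in> cvec n"
  by (auto simp: cvec_def)

lemma cvec_eqI:
  assumes "x \<in> cvec n" "y \<in> cvec n" "\<And>i. i < n \<Longrightarrow> x i = y i"
  shows "x = y"
proof
  fix i show "x i = y i"
    using assms by (cases "i < n") (auto simp: cvec_def)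
qed

lemma abelian_group_cspace: "abelian_group (cspace n)"
proof (rule abelian_groupI)
  fix x assume "x \<in> carrier (cspace n)"
  then show "\<exists>y\<in>carrier (cspace n). y \<oplus>\<^bsub>cspace n\<^esub> x = \<zero>\<^bsub>cspace n\<^esub>"
    by (intro bexI[of _ "\<lambda>i. - x i"]) auto
qed (auto simp: algebra_simps)

lemma cspace_minus [simp]:
  assumes "x \<in> cvec n" "y \<in> cvec n"
  shows "x \<ominus>\<^bsub>cspace n\<^esub> y = (\<lambda>i. x i - y i)"
proof -
  interpret abelian_group "cspace n" by (rule abelian_group_cspace)
  have "\<ominus>\<^bsub>cspace n\<^esub> y = (\<lambda>i. - y i)"
    using assms by (intro minus_equality) auto
  then show ?thesis by (simp add: a_minus_def)
qed

lemma cring_complex_ring: "cring complex_ring"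
proof (rule cringI)
  show "abelian_group complex_ring"
  proof (rule abelian_groupI)
    fix x assume "x \<in> carrier complex_ring"
    then show "\<exists>y\<in>carrier complex_ring. y \<oplus>\<^bsub>complex_ring\<^esub> x = \<zero>\<^bsub>complex_ring\<^esub>"
      by (intro bexI[of _ "- x"]) (auto simp: complex_ring_def)
  qed (auto simp: complex_ring_def)
  show "Group.comm_monoid complex_ring"
    by unfold_locales (auto simp: complex_ring_def)
qed (auto simp: complex_ring_def algebra_simps)

lemma module_cspace: "Module.module complex_ring (cspace n)"
  by (rule moduleI[OF cring_complex_ring abelian_group_cspace])
     (auto simp: complex_ring_def algebra_simps)

section \<open>Inner product and Euclidean norm\<close>

lemma cinner_simps:
  "cinner n (\<lambda>i. x i + y i) z = cinner n x z + cinner n y z"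
  "cinner n (\<lambda>i. x i - y i) z = cinner n x z - cinner n y z"
  "cinner n z (\<lambda>i. x i + y i) = cinner n z x + cinner n z y"
  "cinner n z (\<lambda>i. x i - y i) = cinner n z x - cinner n z y"
  "cinner n (\<lambda>i. c * x i) y = c * cinner n x y"
  "cinner n x (\<lambda>i. c * y i) = cnj c * cinner n x y"
  by (simp_all add: cinner_def algebra_simps sum.distrib sum_subtractf sum_distrib_left)

lemma cinner_commute: "cinner n y x = cnj (cinner n x y)"
  by (simp add: cinner_def mult.commute)

lemma cinner_self: "cinner n x x = of_real ((cnorm n x)\<^sup>2)"
proof -
  have "cinner n x x = of_real (\<Sum>i<n. (cmod (x i))\<^sup>2)"
    unfolding of_real_sum complex_norm_square cinner_def ..
  then show ?thesis
    by (simp add: cnorm_def L2_set_def sum_nonneg)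
qed

lemma cnorm_nonneg [simp]: "0 \<le> cnorm n x"
  by (simp add: cnorm_def)

lemma hnorm_cspace [simp]: "hnorm (cspace n) x = cnorm n x"
  by (simp add: hnorm_def cinner_self)

lemma cnorm_eq_0: "x \<in> cvec n \<Longrightarrow> cnorm n x = 0 \<longleftrightarrow> x = (\<lambda>i. 0)"
  by (auto simp: cnorm_def L2_set_eq_0_iff intro!: cvec_eqI)

lemma cnorm_zero [simp]: "cnorm n (\<lambda>i. 0) = 0"
  by (simp add: cnorm_def L2_set_def)

lemma cnorm_add: "cnorm n (\<lambda>i. x i + y i) \<le> cnorm n x + cnorm n y"
proof -
  have "cnorm n (\<lambda>i. x i + y i) \<le> L2_set (\<lambda>i. cmod (x i) + cmod (y i)) {..<n}"
    unfolding cnorm_def by (intro L2_set_mono norm_triangle_ineq) auto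
  also have "\<dots> \<le> cnorm n x + cnorm n y"
    unfolding cnorm_def by (rule L2_set_triangle_ineq)
  finally show ?thesis .
qed

lemma cnorm_scale: "cnorm n (\<lambda>i. c * x i) = cmod c * cnorm n x"
  by (simp add: cnorm_def norm_mult L2_set_right_distrib)

lemma cnorm_uminus: "cnorm n (\<lambda>i. - x i) = cnorm n x"
  by (simp add: cnorm_def)

lemma cnorm_diff: "cnorm n (\<lambda>i. x i - y i) \<le> cnorm n x + cnorm n y"
  using cnorm_add[of n x "\<lambda>i. - y i"] by (simp add: cnorm_uminus)

lemma norm_component_le: "i < n \<Longrightarrow> cmod (x i) \<le> cnorm n x"
  unfolding cnorm_def by (rule member_le_L2_set[where f = "\<lambda>i. cmod (x i)"]) auto

lemma cnorm_le_sum: "cnorm n x \<le> (\<Sum>i<n. cmod (x i))"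
  unfolding cnorm_def by (rule L2_set_le_sum) auto

text \<open>The crude factor is enough, since it only certifies the boundedness of
  \<open>conj_diag\<close>.\<close>

lemma cnorm_diag_le: "cnorm n (\<lambda>i. e i * x i) \<le> (\<Sum>i<n. cmod (e i)) * cnorm n x"
proof -
  have "cnorm n (\<lambda>i. e i * x i) \<le> L2_set (\<lambda>i. (\<Sum>i<n. cmod (e i)) * cmod (x i)) {..<n}"
    unfolding cnorm_def norm_mult
    by (intro L2_set_mono mult_right_mono member_le_sum) auto
  then show ?thesis
    by (simp add: cnorm_def L2_set_right_distrib sum_nonneg)
qed

lemma cmod_cinner_le: "cmod (cinner n x y) \<le> cnorm n x * cnorm n y"
proof -
  have "cmod (cinner n x y) \<le> (\<Sum>i<n. \<bar>cmod (x i)\<bar> * \<bar>cmod (y i)\<bar>)"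
    unfolding cinner_def by (rule order_trans[OF norm_sum]) (simp add: norm_mult)
  also have "\<dots> \<le> cnorm n x * cnorm n y"
    unfolding cnorm_def by (rule L2_set_mult_ineq)
  finally show ?thesis .
qed

section \<open>Completeness and separability\<close>

lemma complete_cspace:
  assumes u: "\<And>k. u k \<in> cvec n"
    and cauchy: "\<And>e. 0 < e \<Longrightarrow> \<exists>M. \<forall>k\<ge>M. \<forall>l\<ge>M. cnorm n (\<lambda>i. u k i - u l i) < e"
  shows "\<exists>x\<in>cvec n. (\<lambda>k. cnorm n (\<lambda>i. u k i - x i)) \<longlonglongrightarrow> 0"
proof -
  have "\<exists>a. (\<lambda>k. u k i) \<longlonglongrightarrow> a" if "i < n" for i
  proof -
    have "Cauchy (\<lambda>k. u k i)"
    proof (rule CauchyI)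
      fix e :: real assume "0 < e"
      then obtain M where "\<forall>k\<ge>M. \<forall>l\<ge>M. cnorm n (\<lambda>i. u k i - u l i) < e"
        using cauchy by blast
      then show "\<exists>M. \<forall>k\<ge>M. \<forall>l\<ge>M. norm (u k i - u l i) < e"
        using norm_component_le[OF that, of "\<lambda>i. u _ i - u _ i"] by (meson le_less_trans)
    qed
    then show ?thesis by (simp add: Cauchy_convergent_iff convergent_def)
  qed
  then obtain a where a: "\<And>i. i < n \<Longrightarrow> (\<lambda>k. u k i) \<longlonglongrightarrow> a i"
    by metis
  \<comment> \<open>The coordinate limits are cut off at \<open>n\<close> so that the limit lies in
    \<open>cvec n\<close>.\<close>
  define x where "x i = (if i < n then a i else 0)" for i
  have "(\<lambda>k. \<Sum>i<n. cmod (u k i - x i)) \<longlonglongrightarrow> (\<Sum>i<n. cmod (a i - x i))"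
    by (intro tendsto_intros a) auto
  then have "(\<lambda>k. \<Sum>i<n. cmod (u k i - x i)) \<longlonglongrightarrow> 0"
    by (simp add: x_def)
  then have "(\<lambda>k. cnorm n (\<lambda>i. u k i - x i)) \<longlonglongrightarrow> 0"
    by (rule Lim_null_comparison[rotated]) (simp add: cnorm_le_sum)
  moreover have "x \<in> cvec n" by (simp add: cvec_def x_def)
  ultimately show ?thesis by blast
qed

text \<open>The dense set consists of the vectors with coordinates in a countable dense
  \<open>Q\<close>; coding them by lists over \<open>Q\<close> makes countability immediate.\<close>

lemma separable_cspace:
  "\<exists>D\<subseteq>cvec n. countable D \<and> (\<forall>x\<in>cvec n. \<forall>e>0. \<exists>d\<in>D. cnorm n (\<lambda>i. x i - d i) < e)"
proof -
  obtain Q :: "complex set" where Q: "countable Q" "\<And>S. open S \<Longrightarrow> S \<noteq> {} \<Longrightarrow> \<exists>q\<in>Q. q \<in> S"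
    using countable_dense_setE by blast
  define vec where "vec qs = (\<lambda>i. if i < n \<and> i < length qs then qs ! i else 0)"
    for qs :: "complex list"
  define D where "D = vec ` lists Q"
  have "countable D"
    unfolding D_def using Q(1) by (intro countable_image countable_lists)
  moreover have "D \<subseteq> cvec n"
    by (auto simp: D_def vec_def cvec_def)
  moreover have "\<exists>d\<in>D. cnorm n (\<lambda>i. x i - d i) < e" if "x \<in> cvec n" "0 < e" for x e
  proof -
    \<comment> \<open>The \<open>n\<close> coordinate errors add up to less than \<open>e\<close>;
      the extra 1 covers \<open>n = 0\<close>.\<close>
    define r where "r = e / (real n + 1)"
    have r: "0 < r" using \<open>0 < e\<close> by (simp add: r_def)
    have "\<exists>q\<in>Q. q \<in> ball (x i) r" for i
      using Q(2)[of "ball (x i) r"] r by auto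
    then obtain q where q: "\<And>i. q i \<in> Q" "\<And>i. cmod (x i - q i) < r"
      unfolding mem_ball dist_norm by metis
    define d where "d = vec (map q [0..<n])"
    have "d \<in> D" unfolding D_def d_def using q by (intro imageI) auto
    moreover have "cnorm n (\<lambda>i. x i - d i) < e"
    proof -
      have "cnorm n (\<lambda>i. x i - d i) \<le> (\<Sum>i<n. cmod (x i - d i))" by (rule cnorm_le_sum)
      also have "\<dots> \<le> (\<Sum>i<n. r)"
        using q(2) by (intro sum_mono) (auto simp: d_def vec_def less_imp_le)
      also have "\<dots> < e" using \<open>0 < e\<close> by (simp add: r_def field_simps)
      finally show ?thesis .
    qed
    ultimately show ?thesis by blast
  qed
  ultimately show ?thesis by blast
qed

lemma separable_hilbert_space_cspace: "separable_hilbert_space (cspace n)"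
proof -
  interpret Module.module complex_ring "cspace n" by (rule module_cspace)
  show ?thesis
  proof
    fix x y assume "x \<in> carrier (cspace n)" "y \<in> carrier (cspace n)"
    show "ip (cspace n) y x = cnj (ip (cspace n) x y)"
      by (simp add: cinner_commute[of n y x])
  next
    fix x assume "x \<in> carrier (cspace n)" "x \<noteq> \<zero>\<^bsub>cspace n\<^esub>"
    then show "0 < Re (ip (cspace n) x x)"
      using cnorm_eq_0[of x n] by (simp add: cinner_self)
  next
    fix u :: "nat \<Rightarrow> nat \<Rightarrow> complex"
    assume u: "\<And>k. u k \<in> carrier (cspace n)"
      "\<And>e. 0 < e \<Longrightarrow> \<exists>M. \<forall>k\<ge>M. \<forall>l\<ge>M. hnorm (cspace n) (u k \<ominus>\<^bsub>cspace n\<^esub> u l) < e"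
    show "\<exists>x\<in>carrier (cspace n). (\<lambda>k. hnorm (cspace n) (u k \<ominus>\<^bsub>cspace n\<^esub> x)) \<longlonglongrightarrow> 0"
      using complete_cspace[of u n] u by simp
  next
    show "\<exists>D\<subseteq>carrier (cspace n). countable D \<and>
        (\<forall>x\<in>carrier (cspace n). \<forall>e>0. \<exists>d\<in>D. hnorm (cspace n) (x \<ominus>\<^bsub>cspace n\<^esub> d) < e)"
    proof -
      obtain D where D: "D \<subseteq> cvec n" "countable D"
        "\<forall>x\<in>cvec n. \<forall>e>0. \<exists>d\<in>D. cnorm n (\<lambda>i. x i - d i) < e"
        using separable_cspace[of n] by (elim exE conjE)
      have "\<exists>d\<in>D. hnorm (cspace n) (x \<ominus>\<^bsub>cspace n\<^esub> d) < e" if "x \<in> cvec n" "0 < e" for x e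
        
      proof -
        obtain d where "d \<in> D" "cnorm n (\<lambda>i. x i - d i) < e"
          using D(3) \<open>x \<in> cvec n\<close> \<open>0 < e\<close> by meson
        moreover have "d \<in> cvec n" using \<open>d \<in> D\<close> D(1) by (rule subsetD[rotated])
        ultimately show ?thesis using \<open>x \<in> cvec n\<close> by (intro bexI[of _ d]) auto
      qed
      then show ?thesis using D(1,2) by (intro exI[of _ D]) auto
    qed
  qed (auto simp: cinner_simps)
qed

section \<open>Functional calculus of diagonalised operators\<close>

lemma bounded_ops_cspaceI:
  assumes "\<And>x. x \<in> cvec n \<Longrightarrow> T x \<in> cvec n" "\<And>x. x \<notin> cvec n \<Longrightarrow> T x = undefined"
    and "\<And>x y. x \<in> cvec n \<Longrightarrow> y \<in> cvec n \<Longrightarrow> T (\<lambda>i. x i + y i) = (\<lambda>i. T x i + T y i)"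
    and "\<And>c x. x \<in> cvec n \<Longrightarrow> T (\<lambda>i. c * x i) = (\<lambda>i. c * T x i)"
    and "\<And>x. x \<in> cvec n \<Longrightarrow> cnorm n (T x) \<le> K * cnorm n x"
  shows "T \<in> bounded_ops (cspace n)"
  using assms by (auto simp: bounded_ops_def PiE_iff extensional_def intro!: exI[of _ K])

lemma bounded_ops_cspaceD:
  assumes "T \<in> bounded_ops (cspace n)"
  shows "x \<in> cvec n \<Longrightarrow> T x \<in> cvec n" "x \<notin> cvec n \<Longrightarrow> T x = undefined"
    and "x \<in> cvec n \<Longrightarrow> y \<in> cvec n \<Longrightarrow> T (\<lambda>i. x i + y i) = (\<lambda>i. T x i + T y i)"
    and "x \<in> cvec n \<Longrightarrow> T (\<lambda>i. c * x i) = (\<lambda>i. c * T x i)"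
    and "\<exists>K. \<forall>x\<in>cvec n. cnorm n (T x) \<le> K * cnorm n x"
  using assms by (auto simp: bounded_ops_def PiE_iff extensional_def)

text \<open>\<open>op_adjoint\<close> is a definite description, so uniqueness has to be shown: the
  difference of two candidates at \<open>y\<close> is orthogonal to every vector, in particular to
  itself.\<close>

lemma op_adjoint_cspace_eqI:
  assumes S: "S \<in> bounded_ops (cspace n)"
    and adj: "\<And>x y. x \<in> cvec n \<Longrightarrow> y \<in> cvec n \<Longrightarrow> cinner n (T x) y = cinner n x (S y)"
  shows "op_adjoint (cspace n) T = S"
  unfolding op_adjoint_def
proof (rule the_equality)
  fix S' assume S': "S' \<in> bounded_ops (cspace n) \<and>
    (\<forall>x\<in>carrier (cspace n). \<forall>y\<in>carrier (cspace n).
      ip (cspace n) (T x) y = ip (cspace n) x (S' y))"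
  show "S' = S"
  proof
    fix y show "S' y = S y"
    proof (cases "y \<in> cvec n")
      case True
      define w where "w = (\<lambda>i. S' y i - S y i)"
      have w: "w \<in> cvec n"
        using S S' True by (auto simp: w_def dest: bounded_ops_cspaceD)
      have "cinner n w w = cinner n w (S' y) - cinner n w (S y)"
        by (simp add: w_def cinner_simps(4))
      also have "\<dots> = 0" using S' adj w True by (metis cspace_simps(1,5) diff_self)
      finally have "w = (\<lambda>i. 0)" using w cnorm_eq_0 by (simp add: cinner_self)
      then show ?thesis unfolding w_def by (simp add: fun_eq_iff)
    next
      case False
      then show ?thesis using bounded_ops_cspaceD(2)[OF S] bounded_ops_cspaceD(2)[OF conjunct1[OF S']] by simp
    qed
  qed
qed (use assms in auto)

lemma op_norm_cspace_upper:
  assumes "T \<in> bounded_ops (cspace n)" "x \<in> cvec n"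
  shows "cnorm n (T x) \<le> op_norm (cspace n) T * cnorm n x"
proof (cases "cnorm n x = 0")
  case True
  \<comment> \<open>The zero vector cannot be normalised; homogeneity with the scalar 0 gives
    \<open>T x = 0\<close>.\<close>
  then have "x = (\<lambda>i. 0 * x i)" using assms(2) cnorm_eq_0 by simp
  then have "T x = (\<lambda>i. 0 * T x i)" using bounded_ops_cspaceD(4)[OF assms] by metis
  then have "cnorm n (T x) = cnorm n (\<lambda>i. 0 * T x i)" by (rule arg_cong)
  then show ?thesis using True by simp
next
  case False
  define c where "c = complex_of_real (1 / cnorm n x)"
  have c: "cmod c = 1 / cnorm n x" by (simp add: c_def norm_divide)
  obtain K where K: "\<forall>x\<in>cvec n. cnorm n (T x) \<le> K * cnorm n x"
    using bounded_ops_cspaceD(5)[OF assms(1)] by blast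
  have "cnorm n (T (\<lambda>i. c * x i)) \<le> op_norm (cspace n) T"
    unfolding op_norm_def
  proof (rule cSUP_upper2)
    \<comment> \<open>A real supremum is an upper bound only if the set is bounded above.
      \<open>K\<close> may be negative on the zero space, hence
      \<open>\<bar>K\<bar>\<close>.\<close>
    have "cnorm n (T y) \<le> \<bar>K\<bar>" if "y \<in> cvec n" "cnorm n y \<le> 1" for y
    proof -
      have "cnorm n (T y) \<le> \<bar>K\<bar> * cnorm n y"
        using K that(1) by (meson abs_ge_self cnorm_nonneg mult_right_mono order_trans)
      also have "\<dots> \<le> \<bar>K\<bar>" using that(2) by (simp add: mult_left_le)
      finally show ?thesis .
    qed
    then show "bdd_above ((\<lambda>x. hnorm (cspace n) (T x)) `
        {x \<in> carrier (cspace n). hnorm (cspace n) x \<le> 1})"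
      by (intro bdd_aboveI2[where M = "\<bar>K\<bar>"]) simp
    show "(\<lambda>i. c * x i) \<in> {x \<in> carrier (cspace n). hnorm (cspace n) x \<le> 1}"
      using assms(2) False by (simp add: cnorm_scale c)
  qed simp
  then have "cmod c * cnorm n (T x) \<le> op_norm (cspace n) T"
    using bounded_ops_cspaceD(4)[OF assms] by (simp add: cnorm_scale)
  then show ?thesis using False by (simp add: c divide_le_eq less_le)
qed

lemma op_norm_cspace_le:
  assumes "\<And>x. x \<in> cvec n \<Longrightarrow> cnorm n (T x) \<le> K * cnorm n x" "0 \<le> K"
  shows "op_norm (cspace n) T \<le> K"
  unfolding op_norm_def
proof (rule cSUP_least)
  show "{x \<in> carrier (cspace n). hnorm (cspace n) x \<le> 1} \<noteq> {}"
    by (auto intro!: exI[of _ "\<lambda>i. 0"])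
  fix x assume x: "x \<in> {x \<in> carrier (cspace n). hnorm (cspace n) x \<le> 1}"
  then have "cnorm n (T x) \<le> K * cnorm n x" using assms(1) by simp
  also have "\<dots> \<le> K" using x assms(2) by (simp add: mult_left_le)
  finally show "hnorm (cspace n) (T x) \<le> K" by simp
qed

lemma op_norm_cspace_nonneg:
  assumes "T \<in> bounded_ops (cspace n)"
  shows "0 \<le> op_norm (cspace n) T"
proof (cases "n = 0")
  case True
  then have "cvec n = {\<lambda>i. 0}" by (auto simp: cvec_def)
  then show ?thesis by (simp add: op_norm_def cong: conj_cong)
next
  case False
  define b where "b = (\<lambda>i :: nat. if i = 0 then 1 else 0 :: complex)"
  have b: "b \<in> cvec n" using False by (simp add: b_def cvec_def)
  have "0 < cnorm n b" using norm_component_le[of 0 n b] False by (simp add: b_def)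
  moreover have "0 \<le> op_norm (cspace n) T * cnorm n b"
    using cnorm_nonneg op_norm_cspace_upper[OF assms b] by (rule order_trans)
  ultimately show ?thesis by (simp add: zero_le_mult_iff)
qed

lemma bounded_ops_diff:
  assumes S: "S \<in> bounded_ops (cspace n)" and T: "T \<in> bounded_ops (cspace n)"
  shows "op_diff (cspace n) S T \<in> bounded_ops (cspace n)"
proof -
  note D = bounded_ops_cspaceD
  obtain K where K: "\<forall>x\<in>cvec n. cnorm n (S x) \<le> K * cnorm n x" using D(5)[OF S] by blast
  obtain L where L: "\<forall>x\<in>cvec n. cnorm n (T x) \<le> L * cnorm n x" using D(5)[OF T] by blast
  have app: "op_diff (cspace n) S T x = (\<lambda>i. S x i - T x i)" if "x \<in> cvec n" for x
    using that D(1)[OF S that] D(1)[OF T that] by (simp add: op_diff_def)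
  show ?thesis
  proof (rule bounded_ops_cspaceI)
    fix x assume x: "x \<in> cvec n"
    show "op_diff (cspace n) S T x \<in> cvec n"
      using x D(1)[OF S x] D(1)[OF T x] by (simp add: app)
    show "op_diff (cspace n) S T (\<lambda>i. c * x i) = (\<lambda>i. c * op_diff (cspace n) S T x i)" for c
      using x D(4)[OF S x] D(4)[OF T x] by (simp add: app algebra_simps)
    show "cnorm n (op_diff (cspace n) S T x) \<le> (K + L) * cnorm n x"
    proof -
      have "cnorm n (\<lambda>i. S x i - T x i) \<le> cnorm n (S x) + cnorm n (T x)" by (rule cnorm_diff)
      also have "\<dots> \<le> K * cnorm n x + L * cnorm n x" using K L x by (intro add_mono) auto
      finally show ?thesis using x by (simp add: app distrib_right)
    qed
    fix y assume y: "y \<in> cvec n"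
    show "op_diff (cspace n) S T (\<lambda>i. x i + y i) =
        (\<lambda>i. op_diff (cspace n) S T x i + op_diff (cspace n) S T y i)"
      using x y D(3)[OF S x y] D(3)[OF T x y] by (simp add: app algebra_simps)
  qed (simp add: op_diff_def)
qed

text \<open>On a finite spectrum Lagrange interpolation replaces Stone-Weierstrass: a polynomial
  agrees with \<open>f\<close> there, and on polynomials both homomorphisms are determined by their
  values at 1 and at the identity function.\<close>

lemma functional_calculus_unique:
  assumes F: "functional_calculus H N F" and G: "functional_calculus H N G"
    and fin: "finite (op_spectrum H N)"
  shows "F f = G f"
proof -
  let ?S = "op_spectrum H N"
  have cont: "continuous_on ?S g" for g :: "complex \<Rightarrow> complex"
    using fin by (rule continuous_on_finite)
  define E where "E = {g. F g = G g}"
  have one: "(\<lambda>z. 1) \<in> E" and ident: "(\<lambda>z. z) \<in> E"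
    using F G by (auto simp: E_def functional_calculus_def)
  have scale: "(\<lambda>z. c * g z) \<in> E" if "g \<in> E" for c g
    using F G cont that by (auto simp: E_def functional_calculus_def)
  have add: "(\<lambda>z. g z + h z) \<in> E" if "g \<in> E" "h \<in> E" for g h
    using F G cont that by (auto simp: E_def functional_calculus_def)
  have mult: "(\<lambda>z. g z * h z) \<in> E" if "g \<in> E" "h \<in> E" for g h
    using F G cont that by (auto simp: E_def functional_calculus_def)
  have const: "(\<lambda>z. c) \<in> E" for c
    using scale[OF one, of c] by simp
  have prods: "(\<lambda>z. \<Prod>q\<in>A. (z - q) / (p - q)) \<in> E" if "finite A" for A p
    using that
  proof induction
    case (insert q A)
    have "(\<lambda>z. z + - q) \<in> E" by (intro add ident const)
    then have "(\<lambda>z. (z - q) / (p - q)) \<in> E"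
      using scale[of "\<lambda>z. z - q" "1 / (p - q)"] by (simp add: field_simps)
    then have "(\<lambda>z. (z - q) / (p - q) * (\<Prod>q\<in>A. (z - q) / (p - q))) \<in> E"
      by (rule mult[OF _ insert.IH])
    then show ?case using insert.hyps by simp
  qed (use one in simp)
  \<comment> \<open>The Lagrange basis polynomial of the node \<open>p\<close>.\<close>
  define L where "L p z = (\<Prod>q\<in>?S - {p}. (z - q) / (p - q))" for p z :: complex
  have "(\<lambda>z. \<Sum>p\<in>A. f p * L p z) \<in> E" if "finite A" for A
    using that
  proof induction
    case (insert p A)
    have "L p \<in> E" unfolding L_def using fin by (intro prods) simp
    then have "(\<lambda>z. f p * L p z + (\<Sum>p\<in>A. f p * L p z)) \<in> E"
      by (intro add scale insert.IH)
    then show ?case using insert.hyps by simp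
  qed (use const in simp)
  then have "(\<lambda>z. \<Sum>p\<in>?S. f p * L p z) \<in> E" using fin by simp
  moreover have "(\<Sum>p\<in>?S. f p * L p z) = f z" if "z \<in> ?S" for z
  proof -
    have L: "L p z = (if p = z then 1 else 0)" if "p \<in> ?S" for p
      using that \<open>z \<in> ?S\<close> fin by (auto simp: L_def intro!: prod_zero)
    have "(\<Sum>p\<in>?S. f p * L p z) = (\<Sum>p\<in>?S. if p = z then f p else 0)"
      by (intro sum.cong) (auto simp: L)
    then show ?thesis using that fin by simp
  qed
  \<comment> \<open>A calculus sees only values on the spectrum, so the interpolant may be replaced
    by \<open>f\<close>.\<close>
  then have "K (\<lambda>z. \<Sum>p\<in>?S. f p * L p z) = K f" if "functional_calculus H N K" for K
    using that cont unfolding functional_calculus_def by simp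
  note this[OF F] this[OF G]
  ultimately show ?thesis by (simp add: E_def)
qed

lemma op_apply_eqI:
  assumes "functional_calculus H N F" "finite (op_spectrum H N)"
  shows "op_apply H f N = F f"
  unfolding op_apply_def
  using assms functional_calculus_unique by (intro the_equality) blast+


section \<open>Unitary conjugates of diagonal operators\<close>

locale cspace_unitary =
  fixes n :: nat and V V' :: "(nat \<Rightarrow> complex) \<Rightarrow> nat \<Rightarrow> complex"
  assumes closed: "x \<in> cvec n \<Longrightarrow> V x \<in> cvec n" "x \<in> cvec n \<Longrightarrow> V' x \<in> cvec n"
    and add: "x \<in> cvec n \<Longrightarrow> y \<in> cvec n \<Longrightarrow> V (\<lambda>i. x i + y i) = (\<lambda>i. V x i + V y i)"
    and scale: "x \<in> cvec n \<Longrightarrow> V (\<lambda>i. c * x i) = (\<lambda>i. c * V x i)"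
    and inverse: "x \<in> cvec n \<Longrightarrow> V (V' x) = x" "x \<in> cvec n \<Longrightarrow> V' (V x) = x"
    and adjoint: "x \<in> cvec n \<Longrightarrow> y \<in> cvec n \<Longrightarrow> cinner n (V x) y = cinner n x (V' y)"
begin

text \<open>The operator \<open>V D V*\<close> with \<open>D = diag(e)\<close>. Restriction to
  \<open>cvec n\<close> supplies the extensionality that \<open>bounded_ops\<close> demands.\<close>

definition conj_diag :: "(nat \<Rightarrow> complex) \<Rightarrow> (nat \<Rightarrow> complex) \<Rightarrow> nat \<Rightarrow> complex" where
  "conj_diag e = (\<lambda>x\<in>cvec n. V (\<lambda>i. e i * V' x i))"

lemma add': "x \<in> cvec n \<Longrightarrow> y \<in> cvec n \<Longrightarrow> V' (\<lambda>i. x i + y i) = (\<lambda>i. V' x i + V' y i)"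
  using inverse(2)[of "\<lambda>i. V' x i + V' y i"] by (simp add: add inverse closed)

lemma scale': "x \<in> cvec n \<Longrightarrow> V' (\<lambda>i. c * x i) = (\<lambda>i. c * V' x i)"
  using inverse(2)[of "\<lambda>i. c * V' x i"] by (simp add: scale inverse closed)

lemma isometry: "x \<in> cvec n \<Longrightarrow> cnorm n (V x) = cnorm n x"
proof -
  assume x: "x \<in> cvec n"
  have "cinner n (V x) (V x) = cinner n x x"
    using x by (simp add: adjoint closed inverse)
  then have "(cnorm n (V x))\<^sup>2 = (cnorm n x)\<^sup>2"
    by (metis cinner_self of_real_eq_iff)
  then show ?thesis by simp
qed

lemma isometry': "x \<in> cvec n \<Longrightarrow> cnorm n (V' x) = cnorm n x"
  using isometry[of "V' x"] by (simp add: closed inverse)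

lemma conj_diag_bounded: "conj_diag e \<in> bounded_ops (cspace n)"
proof (rule bounded_ops_cspaceI)
  fix x assume x: "x \<in> cvec n"
  have "cnorm n (conj_diag e x) = cnorm n (\<lambda>i. e i * V' x i)"
    using x by (simp add: conj_diag_def isometry closed)
  also have "\<dots> \<le> (\<Sum>i<n. cmod (e i)) * cnorm n x"
    using cnorm_diag_le[of n e "V' x"] x by (simp add: isometry')
  finally show "cnorm n (conj_diag e x) \<le> (\<Sum>i<n. cmod (e i)) * cnorm n x" .
qed (auto simp: conj_diag_def closed add' scale' add[symmetric] scale[symmetric] algebra_simps)

lemma conj_diag_adjoint: "op_adjoint (cspace n) (conj_diag e) = conj_diag (\<lambda>i. cnj (e i))"
proof (rule op_adjoint_cspace_eqI)
  fix x y assume x: "x \<in> cvec n" and y: "y \<in> cvec n"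
  have "cinner n (conj_diag e x) y = cinner n (\<lambda>i. e i * V' x i) (V' y)"
    using x y by (simp add: conj_diag_def adjoint closed)
  also have "\<dots> = cinner n (V' x) (\<lambda>i. cnj (e i) * V' y i)"
    by (simp add: cinner_def algebra_simps)
  also have "\<dots> = cinner n x (conj_diag (\<lambda>i. cnj (e i)) y)"
    using x y adjoint[of "V' x" "V (\<lambda>i. cnj (e i) * V' y i)"]
    by (simp add: conj_diag_def closed inverse)
  finally show "cinner n (conj_diag e x) y = cinner n x (conj_diag (\<lambda>i. cnj (e i)) y)" .
qed (rule conj_diag_bounded)

lemma conj_diag_compose:
  "compose (cvec n) (conj_diag e) (conj_diag e') = conj_diag (\<lambda>i. e i * e' i)"
  by (auto simp: compose_def conj_diag_def closed inverse fun_eq_iff mult.assoc)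

lemma conj_diag_add:
  "op_add (cspace n) (conj_diag e) (conj_diag e') = conj_diag (\<lambda>i. e i + e' i)"
  by (auto simp: op_add_def conj_diag_def closed add[symmetric] fun_eq_iff algebra_simps)

lemma conj_diag_scale:
  "op_scale (cspace n) c (conj_diag e) = conj_diag (\<lambda>i. c * e i)"
  by (auto simp: op_scale_def conj_diag_def closed scale[symmetric] fun_eq_iff algebra_simps)

lemma conj_diag_one: "conj_diag (\<lambda>i. 1) = op_id (cspace n)"
  by (auto simp: op_id_def conj_diag_def inverse fun_eq_iff)

lemma conj_diag_diff:
  "op_diff (cspace n) (conj_diag e) (conj_diag e') = conj_diag (\<lambda>i. e i - e' i)"
proof -
  have "conj_diag (\<lambda>i. e i - e' i) =
      op_add (cspace n) (conj_diag e) (op_scale (cspace n) (-1) (conj_diag e'))"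
    unfolding conj_diag_scale conj_diag_add by simp
  also have "\<dots> = op_diff (cspace n) (conj_diag e) (conj_diag e')"
    by (auto simp: op_add_def op_diff_def op_scale_def fun_eq_iff conj_diag_def closed)
  finally show ?thesis by simp
qed

text \<open>From index \<open>n\<close> on the entries only meet zero coordinates. Hence functions
  that agree on the eigenvalues give the same operator.\<close>

lemma conj_diag_cong: "(\<And>i. i < n \<Longrightarrow> e i = e' i) \<Longrightarrow> conj_diag e = conj_diag e'"
proof -
  assume e: "\<And>i. i < n \<Longrightarrow> e i = e' i"
  have "(\<lambda>i. e i * V' x i) = (\<lambda>i. e' i * V' x i)" if "x \<in> cvec n" for x
    using e closed(2)[OF that] by (intro cvec_eqI[of _ n]) auto
  then show ?thesis
    unfolding conj_diag_def by (intro restrict_ext arg_cong[where f = V])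
qed

lemma conj_diag_normal: "conj_diag e \<in> normal_ops (cspace n)"
  by (simp add: normal_ops_def conj_diag_bounded conj_diag_adjoint conj_diag_compose mult.commute)

text \<open>If \<open>c = d k\<close>, the shifted operator kills the image under \<open>V\<close>
  of the unit vector \<open>b\<close> at \<open>k\<close>, so it has no left inverse. Otherwise the
  reciprocal diagonal inverts it.\<close>

lemma conj_diag_spectrum: "op_spectrum (cspace n) (conj_diag d) = d ` {..<n}"
proof -
  have shift: "op_diff (cspace n) (conj_diag d) (op_scale (cspace n) c (op_id (cspace n))) =
      conj_diag (\<lambda>i. d i - c)" for c
    unfolding conj_diag_one[symmetric] conj_diag_scale conj_diag_diff by simp
  have "c \<in> op_spectrum (cspace n) (conj_diag d)" if c: "c \<in> d ` {..<n}" for c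
  proof -
    obtain k where k: "k < n" "c = d k" using c by auto
    define b where "b = (\<lambda>i. if i = k then 1 else 0 :: complex)"
    have b: "b \<in> cvec n" using k by (simp add: b_def cvec_def)
    have "(\<lambda>i. (d i - c) * b i) = (\<lambda>i. 0)" using k by (auto simp: b_def)
    then have "conj_diag (\<lambda>i. d i - c) (V b) = V (\<lambda>i. 0)"
      using b by (simp add: conj_diag_def closed inverse)
    also have "\<dots> = (\<lambda>i. 0)" using scale[of "\<lambda>i. 0" 0] by simp
    finally have b0: "conj_diag (\<lambda>i. d i - c) (V b) = (\<lambda>i. 0)" .
    show ?thesis
      unfolding op_spectrum_def mem_Collect_eq shift
    proof
      assume "\<exists>S\<in>bounded_ops (cspace n).
         compose (carrier (cspace n)) S (conj_diag (\<lambda>i. d i - c)) = op_id (cspace n) \<and>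
         compose (carrier (cspace n)) (conj_diag (\<lambda>i. d i - c)) S = op_id (cspace n)"
      then obtain S where S: "S \<in> bounded_ops (cspace n)"
        "compose (cvec n) S (conj_diag (\<lambda>i. d i - c)) = op_id (cspace n)" by auto
      have "V b = S (\<lambda>i. 0)"
        using fun_cong[OF S(2), of "V b"] b b0 by (simp add: compose_def op_id_def closed)
      also have "\<dots> = (\<lambda>i. 0)" using bounded_ops_cspaceD(4)[OF S(1), of "\<lambda>i. 0" 0] by simp
      finally have "cnorm n b = 0" using isometry[OF b] by simp
      then have "b = (\<lambda>i. 0)" using b cnorm_eq_0 by simp
      then show False by (metis b_def one_neq_zero)
    qed
  qed
  moreover have "c \<notin> op_spectrum (cspace n) (conj_diag d)" if c: "c \<notin> d ` {..<n}" for c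
  proof -
    \<comment> \<open>The product of the two factors is 1 below \<open>n\<close>; at later indices
      it may be 0 because \<open>1 / 0 = 0\<close>, which \<open>conj_diag_cong\<close>
      ignores.\<close>
    have "conj_diag (\<lambda>i. (d i - c) * (1 / (d i - c))) = op_id (cspace n)"
      unfolding conj_diag_one[symmetric] using c by (intro conj_diag_cong) auto
    then show ?thesis
      unfolding op_spectrum_def mem_Collect_eq shift
      by (auto simp: conj_diag_compose conj_diag_bounded mult.commute
          intro!: bexI[of _ "conj_diag (\<lambda>i. 1 / (d i - c))"])
  qed
  ultimately show ?thesis by blast
qed

lemma conj_diag_functional_calculus:
  "functional_calculus (cspace n) (conj_diag d) (\<lambda>f. conj_diag (\<lambda>i. f (d i)))"
  unfolding functional_calculus_def
proof (intro allI impI conjI)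
  fix f g :: "complex \<Rightarrow> complex"
  assume "\<forall>z\<in>op_spectrum (cspace n) (conj_diag d). f z = g z"
  then show "conj_diag (\<lambda>i. f (d i)) = conj_diag (\<lambda>i. g (d i))"
    by (intro conj_diag_cong) (simp add: conj_diag_spectrum)
qed (simp_all only: conj_diag_bounded conj_diag_adjoint conj_diag_scale conj_diag_add
      conj_diag_compose conj_diag_one cspace_simps)

lemma op_apply_conj_diag: "op_apply (cspace n) f (conj_diag d) = conj_diag (\<lambda>i. f (d i))"
  by (rule op_apply_eqI[OF conj_diag_functional_calculus]) (simp add: conj_diag_spectrum)

end

lemma cspace_unitary_id: "cspace_unitary n (\<lambda>x. x) (\<lambda>x. x)"
  by unfold_locales auto

section \<open>The Cayley transform\<close>

definition mat_app :: "nat \<Rightarrow> (nat \<Rightarrow> nat \<Rightarrow> complex) \<Rightarrow> (nat \<Rightarrow> complex) \<Rightarrow> nat \<Rightarrow> complex" where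
  "mat_app n r x = (\<lambda>i. if i < n then \<Sum>j<n. r i j * x j else 0)"

lemma mat_app_closed [simp, intro]: "mat_app n r x \<in> cvec n"
  by (simp add: mat_app_def cvec_def)

lemma mat_app_simps:
  "mat_app n r (\<lambda>i. x i + y i) = (\<lambda>i. mat_app n r x i + mat_app n r y i)"
  "mat_app n r (\<lambda>i. x i - y i) = (\<lambda>i. mat_app n r x i - mat_app n r y i)"
  "mat_app n r (\<lambda>i. c * x i) = (\<lambda>i. c * mat_app n r x i)"
  "mat_app n (\<lambda>i j. - r i j) x = (\<lambda>i. - mat_app n r x i)"
  by (auto simp: mat_app_def algebra_simps sum.distrib sum_subtractf sum_distrib_left
      sum_negf fun_eq_iff)

text \<open>Crude, but for \<open>n = 2^L\<close> and entries of modulus at most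
  \<open>4^L / 16^L\<close> the factor is exactly 1.\<close>

lemma cnorm_mat_app_le:
  assumes "\<And>i j. i < n \<Longrightarrow> j < n \<Longrightarrow> cmod (r i j) \<le> K"
  shows "cnorm n (mat_app n r x) \<le> (real n)\<^sup>2 * K * cnorm n x"
proof -
  have "cnorm n (mat_app n r x) \<le> (\<Sum>i<n. cmod (\<Sum>j<n. r i j * x j))"
    using cnorm_le_sum[of n "mat_app n r x"] by (simp add: mat_app_def)
  also have "\<dots> \<le> (\<Sum>i<n. \<Sum>j<n. cmod (r i j) * cmod (x j))"
    by (intro sum_mono order_trans[OF norm_sum]) (simp add: norm_mult)
  also have "\<dots> \<le> (\<Sum>i<n. \<Sum>j<n. K * cnorm n x)"
  proof (intro sum_mono mult_mono)
    fix i j assume ij: "i \<in> {..<n}" "j \<in> {..<n}"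
    show "cmod (r i j) \<le> K" "cmod (x j) \<le> cnorm n x"
      using assms norm_component_le ij by auto
    then show "0 \<le> K" by (meson norm_ge_zero order_trans)
  qed auto
  also have "\<dots> = (real n)\<^sup>2 * K * cnorm n x"
    by (simp add: power2_eq_square)
  finally show ?thesis .
qed

text \<open>For skew-hermitian \<open>r\<close> the map \<open>1 - R\<close> is bijective on
  \<open>cvec n\<close>, so the choice is unique and this is its inverse there.\<close>

definition resolvent :: "nat \<Rightarrow> (nat \<Rightarrow> nat \<Rightarrow> complex) \<Rightarrow> (nat \<Rightarrow> complex) \<Rightarrow> nat \<Rightarrow> complex" where
  "resolvent n r x = (SOME y. y \<in> cvec n \<and> (\<lambda>i. y i - mat_app n r y i) = x)"

text \<open>The transform \<open>(1 + R) (1 - R)^-1\<close>.\<close>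

definition cayley :: "nat \<Rightarrow> (nat \<Rightarrow> nat \<Rightarrow> complex) \<Rightarrow> (nat \<Rightarrow> complex) \<Rightarrow> nat \<Rightarrow> complex" where
  "cayley n r x = (\<lambda>i. resolvent n r x i + mat_app n r (resolvent n r x) i)"

section \<open>Skew-hermitian matrices and unitarity of the Cayley transform\<close>

locale skew_hermitian =
  fixes n :: nat and r :: "nat \<Rightarrow> nat \<Rightarrow> complex"
  assumes skew: "i < n \<Longrightarrow> j < n \<Longrightarrow> r j i = - cnj (r i j)"
begin

abbreviation R where "R \<equiv> mat_app n r"

lemma cinner_R: "cinner n (R x) y = - cinner n x (R y)"
proof -
  have "cinner n (R x) y = (\<Sum>i<n. \<Sum>j<n. r i j * x j * cnj (y i))"
    by (simp add: cinner_def mat_app_def sum_distrib_right)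
  also have "\<dots> = (\<Sum>j<n. \<Sum>i<n. r i j * x j * cnj (y i))"
    by (rule sum.swap)
  also have "\<dots> = (\<Sum>j<n. \<Sum>i<n. - (x j * cnj (r j i * y i)))"
  proof (intro sum.cong refl)
    fix i j assume "i \<in> {..<n}" "j \<in> {..<n}"
    then have "r j i = - cnj (r i j)" by (intro skew) simp_all
    then show "r i j * x j * cnj (y i) = - (x j * cnj (r j i * y i))" by simp
  qed
  also have "\<dots> = - cinner n x (R y)"
    by (simp add: cinner_def mat_app_def sum_negf sum_distrib_left)
  finally show ?thesis .
qed

lemma Re_cinner_R: "Re (cinner n (R y) y) = 0" "Re (cinner n y (R y)) = 0"
  using cinner_R[of y y] cinner_commute[of n "R y" y] by (auto dest: arg_cong[where f = Re])

text \<open>The mixed term is twice the real part of \<open><y, R y>\<close>, which vanishes by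
  skewness. Consequently \<open>1 + R\<close> and \<open>1 - R\<close> do not decrease
  norms.\<close>

lemma cnorm_add_R:
  "(cnorm n (\<lambda>i. y i + R y i))\<^sup>2 = (cnorm n y)\<^sup>2 + (cnorm n (R y))\<^sup>2"
  "(cnorm n (\<lambda>i. y i - R y i))\<^sup>2 = (cnorm n y)\<^sup>2 + (cnorm n (R y))\<^sup>2"
proof -
  have norm2: "(cnorm n x)\<^sup>2 = Re (cinner n x x)" for x
    by (simp add: cinner_self)
  show "(cnorm n (\<lambda>i. y i + R y i))\<^sup>2 = (cnorm n y)\<^sup>2 + (cnorm n (R y))\<^sup>2"
    "(cnorm n (\<lambda>i. y i - R y i))\<^sup>2 = (cnorm n y)\<^sup>2 + (cnorm n (R y))\<^sup>2"
    by (simp_all add: norm2 cinner_simps Re_cinner_R)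
qed

lemma cnorm_le_add_R:
  "cnorm n y \<le> cnorm n (\<lambda>i. y i + R y i)" "cnorm n y \<le> cnorm n (\<lambda>i. y i - R y i)"
  by (rule power2_le_imp_le; simp add: cnorm_add_R)+

lemma inj_sub_R:
  assumes "y \<in> cvec n" "z \<in> cvec n" "(\<lambda>i. y i - R y i) = (\<lambda>i. z i - R z i)"
  shows "y = z"
proof -
  define w where "w = (\<lambda>i. y i - z i)"
  have w: "w \<in> cvec n" using assms by (simp add: w_def)
  have "(\<lambda>i. w i - R w i) = (\<lambda>i. (y i - R y i) - (z i - R z i))"
    by (simp add: w_def mat_app_simps fun_eq_iff)
  also have "\<dots> = (\<lambda>i. 0)" using assms(3) by (simp add: fun_eq_iff)
  finally have "cnorm n w \<le> 0" using cnorm_le_add_R(2)[of w] by simp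
  then have "w = (\<lambda>i. 0)" using cnorm_eq_0[OF w] by (simp add: order_antisym)
  then show ?thesis by (simp add: w_def fun_eq_iff)
qed

text \<open>In finite dimension injectivity of \<open>1 - R\<close> forces surjectivity. The
  argument passes to the matrix \<open>A\<close> of \<open>1 - R\<close>: a zero determinant would
  give a nonzero kernel vector.\<close>

lemma surj_sub_R:
  assumes x: "x \<in> cvec n"
  shows "\<exists>y\<in>cvec n. x = (\<lambda>i. y i - R y i)"
proof -
  define A where "A = mat n n (\<lambda>(i, j). (if i = j then 1 else 0) - r i j)"
  define coords where "coords v = (\<lambda>i. if i < n then vec_index v i else 0)" for v :: "complex vec"
  have A: "A \<in> carrier_mat n n" by (simp add: A_def)
  have coords: "coords v \<in> cvec n" for v by (simp add: coords_def cvec_def)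
  have A_mult: "coords (A *\<^sub>v v) = (\<lambda>i. coords v i - R (coords v) i)" if "v \<in> carrier_vec n" for v
  proof (rule cvec_eqI[of _ n])
    fix i assume i: "i < n"
    have "coords (A *\<^sub>v v) i = (\<Sum>j<n. ((if i = j then 1 else 0) - r i j) * vec_index v j)"
      using i that by (simp add: coords_def A_def scalar_prod_def atLeast0LessThan)
    also have "\<dots> = coords v i - R (coords v) i"
      using i by (simp add: coords_def mat_app_def left_diff_distrib sum_subtractf mult_delta_left)
    finally show "coords (A *\<^sub>v v) i = coords v i - R (coords v) i" .
  qed (auto intro: coords)
  have "det A \<noteq> 0"
  proof
    assume "det A = 0"
    then obtain v where v: "v \<in> carrier_vec n" "v \<noteq> 0\<^sub>v n" "A *\<^sub>v v = 0\<^sub>v n"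
      using det_0_iff_vec_prod_zero[OF A] by blast
    have "(\<lambda>i. coords v i - R (coords v) i) = coords (0\<^sub>v n)"
      using A_mult[OF v(1)] v(3) by simp
    also have "\<dots> = (\<lambda>i. 0)" by (auto simp: coords_def)
    also have "\<dots> = (\<lambda>i. 0 - R (\<lambda>i. 0) i)" by (auto simp: mat_app_def)
    finally have v0: "coords v = (\<lambda>i. 0)" by (rule inj_sub_R[OF coords cvec_closed(1)])
    have "vec_index v i = 0" if "i < n" for i
    proof -
      have "coords v i = 0" unfolding v0 ..
      then show ?thesis using that by (simp add: coords_def)
    qed
    then have "v = 0\<^sub>v n" using v(1) by (intro eq_vecI) auto
    with v(2) show False by contradiction
  qed
  then have "A \<in> Units (ring_mat TYPE(complex) n ())"
    by (rule det_non_zero_imp_unit[OF A])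
  then obtain B where B: "B \<in> carrier_mat n n" "A * B = 1\<^sub>m n"
    by (auto simp: Units_def ring_mat_def)
  define v where "v = B *\<^sub>v vec n x"
  have v: "v \<in> carrier_vec n" using B(1) by (simp add: v_def)
  have "A *\<^sub>v v = vec n x"
    using A B by (simp add: v_def assoc_mult_mat_vec[symmetric, of A n n B n])
  then have "(\<lambda>i. coords v i - R (coords v) i) = coords (vec n x)"
    using A_mult[OF v] by simp
  moreover have "coords (vec n x) = x" using x by (auto simp: coords_def cvec_def)
  ultimately show ?thesis using coords[of v] by (intro bexI[of _ "coords v"]) simp_all
qed

lemma resolvent_sub_R:
  assumes "y \<in> cvec n"
  shows "resolvent n r (\<lambda>i. y i - R y i) = y"
proof -
  let ?x = "\<lambda>i. y i - R y i"
  have *: "resolvent n r ?x \<in> cvec n \<and>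
      (\<lambda>i. resolvent n r ?x i - R (resolvent n r ?x) i) = ?x"
    unfolding resolvent_def
    using someI[of "\<lambda>z. z \<in> cvec n \<and> (\<lambda>i. z i - R z i) = ?x" y] assms by simp
  show ?thesis by (rule inj_sub_R[OF conjunct1[OF *] assms conjunct2[OF *]])
qed

lemma cayley_sub_R: "y \<in> cvec n \<Longrightarrow> cayley n r (\<lambda>i. y i - R y i) = (\<lambda>i. y i + R y i)"
  by (simp add: cayley_def resolvent_sub_R)

text \<open>Transfers facts about \<open>1 - R\<close> to \<open>1 + R\<close>, and makes the
  transform of \<open>-R\<close> available as the inverse of that of \<open>R\<close>.\<close>

lemma skew_hermitian_uminus: "skew_hermitian n (\<lambda>i j. - r i j)"
proof
  fix i j assume "i < n" "j < n"
  then have "r j i = - cnj (r i j)" by (rule skew)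
  then show "- r j i = - cnj (- r i j)" by simp
qed

lemma surj_add_R:
  assumes "x \<in> cvec n"
  shows "\<exists>y\<in>cvec n. x = (\<lambda>i. y i + R y i)"
  using skew_hermitian.surj_sub_R[OF skew_hermitian_uminus assms] by (simp add: mat_app_simps)

lemma cayley_uminus_add_R:
  "y \<in> cvec n \<Longrightarrow> cayley n (\<lambda>i j. - r i j) (\<lambda>i. y i + R y i) = (\<lambda>i. y i - R y i)"
  using skew_hermitian.cayley_sub_R[OF skew_hermitian_uminus, of y] by (simp add: mat_app_simps)

text \<open>Every vector has the forms \<open>y - R y\<close> and \<open>z + R z\<close>. The
  transform maps \<open>y - R y\<close> to \<open>y + R y\<close>, and that of \<open>-R\<close>
  maps \<open>z + R z\<close> to \<open>z - R z\<close>; the unitary laws are read off from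
  this.\<close>

sublocale cayley: cspace_unitary n "cayley n r" "cayley n (\<lambda>i j. - r i j)"
proof
  fix x assume x: "x \<in> cvec n"
  obtain y where y: "y \<in> cvec n" "x = (\<lambda>i. y i - R y i)" using surj_sub_R[OF x] by (rule bexE)
  obtain z where z: "z \<in> cvec n" "x = (\<lambda>i. z i + R z i)" using surj_add_R[OF x] by (rule bexE)
  show "cayley n r x \<in> cvec n"
    using y by (simp add: cayley_sub_R)
  show "cayley n (\<lambda>i j. - r i j) x \<in> cvec n"
    using z by (simp add: cayley_uminus_add_R)
  show "cayley n r (cayley n (\<lambda>i j. - r i j) x) = x"
    using z by (simp add: cayley_sub_R cayley_uminus_add_R)
  show "cayley n (\<lambda>i j. - r i j) (cayley n r x) = x"
    using y by (simp add: cayley_sub_R cayley_uminus_add_R)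
  show "cayley n r (\<lambda>i. c * x i) = (\<lambda>i. c * cayley n r x i)" for c
    using cayley_sub_R[of "\<lambda>i. c * y i"] y
    by (simp add: cayley_sub_R mat_app_simps right_diff_distrib distrib_left)
  fix x' assume x': "x' \<in> cvec n"
  obtain y' where y': "y' \<in> cvec n" "x' = (\<lambda>i. y' i - R y' i)" using surj_sub_R[OF x'] by (rule bexE)
  obtain z' where z': "z' \<in> cvec n" "x' = (\<lambda>i. z' i + R z' i)" using surj_add_R[OF x'] by (rule bexE)
  show "cayley n r (\<lambda>i. x i + x' i) = (\<lambda>i. cayley n r x i + cayley n r x' i)"
    using cayley_sub_R[of "\<lambda>i. y i + y' i"] y y'
    by (simp add: cayley_sub_R mat_app_simps algebra_simps)
  \<comment> \<open>With \<open>x = y - R y\<close> and \<open>x' = z' + R z'\<close> the mixed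
    terms cancel by skewness, and both sides equal \<open><y, z'> + <R y, R z'>\<close>.\<close>
  show "cinner n (cayley n r x) x' = cinner n x (cayley n (\<lambda>i j. - r i j) x')"
    by (simp add: y z' cayley_sub_R cayley_uminus_add_R cinner_simps cinner_R)
qed

text \<open>Treats the plain diagonal operator as a conjugate too, so one set of lemmas serves both
  members of the pair.\<close>

sublocale ident: cspace_unitary n "\<lambda>x. x" "\<lambda>x. x"
  by (rule cspace_unitary_id)

text \<open>With \<open>W = (1 + R) (1 - R)\<inverse>\<close> this is the identity
  \<open>[e, W] (1 - R) = (1 + W) [e, R]\<close>: the commutator with \<open>W\<close> is exactly, not only to first
  order, controlled by the one with \<open>R\<close>.\<close>

lemma conj_diag_cayley_diff:
  fixes e :: "nat \<Rightarrow> complex"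
  assumes y: "y \<in> cvec n"
  defines "u \<equiv> (\<lambda>i. e i * R y i - R (\<lambda>i. e i * y i) i)"
  shows "op_diff (cspace n) (ident.conj_diag e) (cayley.conj_diag e) (\<lambda>i. y i + R y i) =
    (\<lambda>i. u i + cayley n r u i)"
proof -
  let ?W = "cayley n r"
  have u: "u \<in> cvec n" using y by (simp add: u_def)
  have ey: "(\<lambda>i. e i * y i) \<in> cvec n" using y by simp
  have minus: "?W (\<lambda>i. - u i) = (\<lambda>i. - ?W u i)" using cayley.scale[OF u, of "- 1"] by simp
  \<comment> \<open>With \<open>e\<close> as multiplication operator,
    \<open>e (1 - R) y = (1 - R) (e y) - u\<close>, and \<open>W\<close> is known on the range of
    \<open>1 - R\<close>.\<close>
  have "?W (\<lambda>i. e i * (y i - R y i)) =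
      ?W (\<lambda>i. ((e i * y i) - R (\<lambda>i. e i * y i) i) + (- 1) * u i)"
    by (simp add: u_def algebra_simps)
  also have "\<dots> = (\<lambda>i. (e i * y i + R (\<lambda>i. e i * y i) i) + (- 1) * ?W u i)"
    using u ey by (subst cayley.add) (auto simp: cayley_sub_R minus)
  finally have W: "?W (\<lambda>i. e i * (y i - R y i)) =
      (\<lambda>i. (e i * y i + R (\<lambda>i. e i * y i) i) - ?W u i)" by simp
  have sum: "(\<lambda>i. y i + R y i) \<in> cvec n" using y by auto
  have "cayley.conj_diag e (\<lambda>i. y i + R y i) = ?W (\<lambda>i. e i * (y i - R y i))"
    using y sum by (simp add: cayley.conj_diag_def cayley_uminus_add_R)
  moreover have "cayley.conj_diag e (\<lambda>i. y i + R y i) \<in> cvec n"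
    using bounded_ops_cspaceD(1)[OF cayley.conj_diag_bounded sum] .
  ultimately show ?thesis
    using sum unfolding W
    by (simp add: op_diff_def ident.conj_diag_def) (simp add: u_def fun_eq_iff algebra_simps)
qed

text \<open>Every \<open>x\<close> is some \<open>y + R y\<close> with
  \<open>cnorm n y \<le> cnorm n x\<close>. The difference maps it to \<open>u + W u\<close>, whose
  norm is at most twice that of the commutator term \<open>u\<close> because \<open>W\<close> is
  isometric.\<close>

lemma op_norm_diff_cayley_le:
  assumes "\<And>y. y \<in> cvec n \<Longrightarrow> cnorm n (\<lambda>i. e i * R y i - R (\<lambda>i. e i * y i) i) \<le> K * cnorm n y"
    and "0 \<le> K"
  shows "op_norm (cspace n) (op_diff (cspace n) (ident.conj_diag e) (cayley.conj_diag e)) \<le> 2 * K"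
proof (rule op_norm_cspace_le)
  fix x assume "x \<in> cvec n"
  then obtain y where y: "y \<in> cvec n" and x: "x = (\<lambda>i. y i + R y i)" using surj_add_R by blast
  define u where "u = (\<lambda>i. e i * R y i - R (\<lambda>i. e i * y i) i)"
  have u: "u \<in> cvec n" using y by (simp add: u_def)
  have "cnorm n (\<lambda>i. u i + cayley n r u i) \<le> cnorm n u + cnorm n u"
    using cnorm_add[of n u "cayley n r u"] u by (simp add: cayley.isometry)
  also have "\<dots> \<le> 2 * K * cnorm n y" using assms(1)[OF y] by (simp add: u_def)
  also have "\<dots> \<le> 2 * K * cnorm n x"
    unfolding x using assms(2) by (intro mult_left_mono cnorm_le_add_R) auto
  finally show "cnorm n (op_diff (cspace n) (ident.conj_diag e) (cayley.conj_diag e) x)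
      \<le> 2 * K * cnorm n x"
    using conj_diag_cayley_diff[OF y, of e] by (simp add: x u_def)
qed (use assms in simp)

text \<open>The terms \<open>u\<close> and \<open>W u\<close> cannot cancel: for
  \<open>u = (1 - R) q\<close> their sum is \<open>2 q\<close>, and contractivity of
  \<open>R\<close> gives \<open>\<parallel>u\<parallel> \<le> 2 \<parallel>q\<parallel>\<close>. The
  factor 2 in the bound comes from \<open>\<parallel>y + R y\<parallel> \<le> 2
  \<parallel>y\<parallel>\<close>.\<close>

lemma op_norm_diff_cayley_ge:
  assumes R: "\<And>y. y \<in> cvec n \<Longrightarrow> cnorm n (R y) \<le> cnorm n y" and y: "y \<in> cvec n"
  shows "cnorm n (\<lambda>i. e i * R y i - R (\<lambda>i. e i * y i) i) \<le>
    op_norm (cspace n) (op_diff (cspace n) (ident.conj_diag e) (cayley.conj_diag e))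
      * (2 * cnorm n y)"
proof -
  define u where "u = (\<lambda>i. e i * R y i - R (\<lambda>i. e i * y i) i)"
  define T where "T = op_diff (cspace n) (ident.conj_diag e) (cayley.conj_diag e)"
  have u: "u \<in> cvec n" using y by (simp add: u_def)
  then obtain q where q: "q \<in> cvec n" "u = (\<lambda>i. q i - R q i)" using surj_sub_R by blast
  have T: "T \<in> bounded_ops (cspace n)"
    unfolding T_def by (intro bounded_ops_diff ident.conj_diag_bounded cayley.conj_diag_bounded)
  have "(\<lambda>i. y i + R y i) \<in> cvec n" using y by auto
  with T have "cnorm n (T (\<lambda>i. y i + R y i)) \<le>
      op_norm (cspace n) T * cnorm n (\<lambda>i. y i + R y i)"
    by (rule op_norm_cspace_upper)
  moreover have "T (\<lambda>i. y i + R y i) = (\<lambda>i. 2 * q i)"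
  proof -
    have "T (\<lambda>i. y i + R y i) = (\<lambda>i. u i + cayley n r u i)"
      using conj_diag_cayley_diff[OF y, of e] by (simp add: T_def u_def)
    then show ?thesis unfolding q(2) by (simp add: q(1) cayley_sub_R)
  qed
  then have "cnorm n (T (\<lambda>i. y i + R y i)) = 2 * cnorm n q"
    by (simp add: cnorm_scale)
  moreover have "cnorm n u \<le> 2 * cnorm n q"
    using cnorm_diff[of n q "R q"] R[OF q(1)] q(2) by simp
  ultimately have "cnorm n u \<le> op_norm (cspace n) T * cnorm n (\<lambda>i. y i + R y i)" by linarith
  also have "\<dots> \<le> op_norm (cspace n) T * (2 * cnorm n y)"
    using cnorm_add[of n y "R y"] R[OF y] by (intro mult_left_mono) (auto intro: op_norm_cspace_nonneg T)
  finally show ?thesis by (simp add: u_def T_def)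
qed

end

section \<open>The dyadic example\<close>

text \<open>The points \<open>\<lambda>(x)\<close>; the lowest binary digit becomes the leading
  base-4 digit.\<close>

primrec cantor_pt :: "nat \<Rightarrow> nat \<Rightarrow> real" where
  "cantor_pt 0 x = 0"
| "cantor_pt (Suc L) x = (real (x mod 2) + cantor_pt L (x div 2)) / 4"

text \<open>The points \<open>\<phi>(x)\<close>; the subtraction in the recursion produces the
  alternating signs.\<close>

primrec alt_pt :: "nat \<Rightarrow> nat \<Rightarrow> real" where
  "alt_pt 0 x = 0"
| "alt_pt (Suc L) x = (real (x mod 2) - alt_pt L (x div 2)) / 4"

text \<open>The kernel \<open>B\<close>, governed by the first differing digit. Each further common
  digit doubles the weight and flips the sign.\<close>

primrec alt_kernel :: "nat \<Rightarrow> nat \<Rightarrow> nat \<Rightarrow> real" where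
  "alt_kernel 0 x y = 0"
| "alt_kernel (Suc L) x y =
    (if x mod 2 = y mod 2 then - alt_kernel L (x div 2) (y div 2) else 1 / 2 ^ Suc L)"

lemma alt_kernel_commute: "alt_kernel L x y = alt_kernel L y x"
  by (induction L arbitrary: x y) auto

lemma alt_kernel_diag [simp]: "alt_kernel L x x = 0"
  by (induction L arbitrary: x) auto

lemma abs_alt_kernel_le: "\<bar>alt_kernel L x y\<bar> \<le> 1 / 2"
proof (induction L arbitrary: x y)
  case (Suc L)
  have "(1::real) \<le> 2 ^ L" by simp
  then show ?case using Suc by (simp add: field_simps)
qed simp

lemma mod_2_cases: "real (x mod 2) = 0 \<or> real (x mod 2) = 1"
  by (metis mod2_eq_if of_nat_0 of_nat_1)

text \<open>The constant reproduces itself: \<open>(1 + 1/3) / 4 = 1/3\<close>.\<close>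

lemma abs_quarter_diff_le:
  fixes s t a b :: real
  assumes "0 \<le> s" "s \<le> 1" "0 \<le> t" "t \<le> 1" "\<bar>a - b\<bar> \<le> 1 / 3"
  shows "\<bar>(s + a) / 4 - (t + b) / 4\<bar> \<le> 1 / 3" "\<bar>(s - a) / 4 - (t - b) / 4\<bar> \<le> 1 / 3"
  using assms by argo+

lemma abs_cantor_pt_diff_le: "\<bar>cantor_pt L x - cantor_pt L y\<bar> \<le> 1 / 3"
proof (induction L arbitrary: x y)
  case (Suc L)
  have "0 \<le> real (x mod 2)" "real (x mod 2) \<le> 1" "0 \<le> real (y mod 2)" "real (y mod 2) \<le> 1"
    using mod_2_cases[of x] mod_2_cases[of y] by auto
  then show ?case
    unfolding cantor_pt.simps by (intro abs_quarter_diff_le(1) Suc)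
qed simp

lemma abs_alt_pt_diff_le: "\<bar>alt_pt L x - alt_pt L y\<bar> \<le> 1 / 3"
proof (induction L arbitrary: x y)
  case (Suc L)
  have "0 \<le> real (x mod 2)" "real (x mod 2) \<le> 1" "0 \<le> real (y mod 2)" "real (y mod 2) \<le> 1"
    using mod_2_cases[of x] mod_2_cases[of y] by auto
  then show ?case
    unfolding alt_pt.simps by (intro abs_quarter_diff_le(2) Suc)
qed simp

text \<open>A common lowest digit reduces all claims to the quotients by 2. If the lowest digits
  differ, their difference \<open>s\<close> has modulus 1 and dominates the tails, which are at most
  1/3.\<close>

lemma cantor_pt_separation:
  assumes "x < 2 ^ L" "y < 2 ^ L" "x \<noteq> y"
  shows "2 / 3 / 4 ^ L \<le> \<bar>cantor_pt L x - cantor_pt L y\<bar> \<and>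
    \<bar>alt_pt L x - alt_pt L y\<bar> \<le> 2 * \<bar>cantor_pt L x - cantor_pt L y\<bar> \<and>
    \<bar>alt_kernel L x y\<bar> / 2 \<le>
      alt_kernel L x y * ((alt_pt L x - alt_pt L y) / (cantor_pt L x - cantor_pt L y))"
  using assms
proof (induction L arbitrary: x y)
  case (Suc L)
  define p where "p = cantor_pt L (x div 2) - cantor_pt L (y div 2)"
  define q where "q = alt_pt L (x div 2) - alt_pt L (y div 2)"
  have p: "\<bar>p\<bar> \<le> 1 / 3" and q: "\<bar>q\<bar> \<le> 1 / 3"
    unfolding p_def q_def by (rule abs_cantor_pt_diff_le abs_alt_pt_diff_le)+
  show ?case
  proof (cases "x mod 2 = y mod 2")
    case True
    have "x div 2 \<noteq> y div 2"
      using True Suc.prems(3) by (metis div_mult_mod_eq)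
    then have IH: "2 / 3 / 4 ^ L \<le> \<bar>p\<bar> \<and> \<bar>q\<bar> \<le> 2 * \<bar>p\<bar> \<and>
        \<bar>alt_kernel L (x div 2) (y div 2)\<bar> / 2 \<le> alt_kernel L (x div 2) (y div 2) * (q / p)"
      unfolding p_def q_def using Suc.prems by (intro Suc.IH) auto
    have eqs: "cantor_pt (Suc L) x - cantor_pt (Suc L) y = p / 4"
      "alt_pt (Suc L) x - alt_pt (Suc L) y = - q / 4"
      "alt_kernel (Suc L) x y = - alt_kernel L (x div 2) (y div 2)"
      using True by (simp_all add: p_def q_def diff_divide_distrib add_divide_distrib)
    \<comment> \<open>Kernel and divided difference both change sign, so their product is
      unchanged.\<close>
    show ?thesis unfolding eqs using IH by simp
  next
    case False
    define s where "s = real (x mod 2) - real (y mod 2)"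
    have s: "s = 1 \<or> s = - 1"
      using False mod_2_cases[of x] mod_2_cases[of y] by (auto simp: s_def)
    have eqs: "cantor_pt (Suc L) x - cantor_pt (Suc L) y = (s + p) / 4"
      "alt_pt (Suc L) x - alt_pt (Suc L) y = (s - q) / 4"
      "alt_kernel (Suc L) x y = 1 / 2 ^ Suc L"
      using False by (simp_all add: p_def q_def s_def field_simps)
    have "2 / 3 / 4 ^ Suc L \<le> (2 / 3 / 4 :: real)" by (simp add: field_simps)
    also have "\<dots> \<le> \<bar>(s + p) / 4\<bar>" using s p by (auto simp: field_simps)
    finally have "2 / 3 / 4 ^ Suc L \<le> \<bar>(s + p) / 4\<bar>" .
    moreover have "\<bar>(s - q) / 4\<bar> \<le> 2 * \<bar>(s + p) / 4\<bar>" using s p q by (auto simp: field_simps)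
    \<comment> \<open>Both \<open>s - q\<close> and \<open>s + p\<close> have the sign of
      \<open>s\<close> and modulus between 2/3 and 4/3.\<close>
    moreover have "1 / 2 \<le> ((s - q) / 4) / ((s + p) / 4)"
      using s p q by (auto simp: field_simps)
    then have "1 / 2 ^ Suc L * (1 / 2) \<le> 1 / 2 ^ Suc L * (((s - q) / 4) / ((s + p) / 4))"
      by (intro mult_left_mono) auto
    ultimately show ?thesis unfolding eqs by simp
  qed
qed simp

section \<open>Row sums of the kernel\<close>

lemma sum_lessThan_double:
  fixes g :: "nat \<Rightarrow> 'a::comm_monoid_add"
  shows "sum g {..<2 * m} = (\<Sum>k<m. g (2 * k)) + (\<Sum>k<m. g (Suc (2 * k)))"
  by (induction m) (simp_all add: algebra_simps)

text \<open>Each level adds 1/2: exactly \<open>2^L\<close> of the \<open>2^Suc L\<close> indices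
  differ from \<open>x\<close> in the lowest digit, each with weight
  \<open>1 / 2^Suc L\<close>.\<close>

lemma sum_abs_alt_kernel:
  "(\<Sum>y<2 ^ L. \<bar>alt_kernel L x y\<bar>) = real L / 2"
proof (induction L arbitrary: x)
  case (Suc L)
  have "(\<Sum>y<2 ^ Suc L. \<bar>alt_kernel (Suc L) x y\<bar>) =
      (\<Sum>k<2 ^ L. \<bar>alt_kernel L (x div 2) k\<bar>) + (\<Sum>k<(2::nat) ^ L. 1 / 2 ^ Suc L :: real)"
    unfolding power_Suc[of 2 L] sum_lessThan_double
    by (cases "x mod 2 = 0") (auto simp: mod2_eq_if)
  then show ?case by (simp add: Suc.IH field_simps)
qed simp

text \<open>The signed sums obey \<open>c' = 1/2 - c\<close> from one level to the next and so
  alternate between 0 and 1/2. Their independence of the row makes constants eigenvectors.\<close>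

lemma sum_alt_kernel:
  "\<exists>c. \<bar>c\<bar> \<le> 1 / 2 \<and> (\<forall>x. (\<Sum>y<2 ^ L. alt_kernel L x y) = c)"
proof -
  have "\<forall>x. (\<Sum>y<2 ^ L. alt_kernel L x y) = (if even L then 0 else 1 / 2)"
  proof (induction L)
    case (Suc L)
    have "(\<Sum>y<2 ^ Suc L. alt_kernel (Suc L) x y) =
        - (\<Sum>k<2 ^ L. alt_kernel L (x div 2) k) + (\<Sum>k<(2::nat) ^ L. 1 / 2 ^ Suc L :: real)" for x
      unfolding power_Suc[of 2 L] sum_lessThan_double sum_negf[symmetric]
      by (cases "x mod 2 = 0") (auto simp: mod2_eq_if)
    then show ?case using Suc.IH by simp
  qed simp
  then show ?thesis by (intro exI[of _ "if even L then 0 else 1 / 2"]) auto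
qed

section \<open>Contractivity of the kernel\<close>

text \<open>Pythagoras: constants are orthogonal to vectors of mean zero.\<close>

lemma sum_cmod2_diff_const:
  assumes "(\<Sum>k<m. z k) = 0"
  shows "(\<Sum>k<m. (cmod (b - z k))\<^sup>2) = real m * (cmod b)\<^sup>2 + (\<Sum>k<m. (cmod (z k))\<^sup>2)"
proof -
  have "(cmod (b - z k))\<^sup>2 = (cmod b)\<^sup>2 + (cmod (z k))\<^sup>2 - 2 * Re (cnj b * z k)" for k
    by (simp add: cmod_power2) (simp add: power2_eq_square algebra_simps)
  then have "(\<Sum>k<m. (cmod (b - z k))\<^sup>2) =
      real m * (cmod b)\<^sup>2 + (\<Sum>k<m. (cmod (z k))\<^sup>2) - 2 * Re (cnj b * (\<Sum>k<m. z k))"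
    by (simp add: sum.distrib sum_subtractf sum_distrib_left Re_sum)
  then show ?thesis using assms by simp
qed

text \<open>The mean \<open>\<mu>\<close> of \<open>u\<close> and the fluctuation \<open>u - \<mu>\<close> stay orthogonal under \<open>A\<close>.\<close>

lemma sum_cmod2_mean_split:
  fixes A :: "nat \<Rightarrow> nat \<Rightarrow> real" and u :: "nat \<Rightarrow> complex"
  assumes m: "0 < m" and sym: "\<And>i j. A i j = A j i" and row: "\<And>i. (\<Sum>j<m. A i j) = c"
    and contr: "\<And>w. (\<Sum>i<m. (cmod (\<Sum>j<m. of_real (A i j) * w j))\<^sup>2) \<le> (\<Sum>i<m. (cmod (w i))\<^sup>2)"
  defines "\<mu> \<equiv> (\<Sum>j<m. u j) / of_nat m"
  shows "(\<Sum>i<m. (cmod (b - (\<Sum>j<m. of_real (A i j) * u j)))\<^sup>2) \<le>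
    (\<Sum>i<m. (cmod (u i))\<^sup>2) + real m * (cmod (b - of_real c * \<mu>))\<^sup>2 - real m * (cmod \<mu>)\<^sup>2"
proof -
  define w where "w j = u j - \<mu>" for j
  have sum_w: "(\<Sum>j<m. w j) = 0" using m by (simp add: w_def sum_subtractf \<mu>_def)
  define z where "z i = (\<Sum>j<m. of_real (A i j) * w j)" for i
  have row': "(\<Sum>j<m. complex_of_real (A i j)) = of_real c" for i
    using row[of i] by (simp flip: of_real_sum)
  \<comment> \<open>Symmetry turns constant row sums into constant column sums, so \<open>A\<close>
    preserves mean zero.\<close>
  have "(\<Sum>i<m. z i) = (\<Sum>j<m. \<Sum>i<m. of_real (A i j) * w j)"
    unfolding z_def by (rule sum.swap)
  also have "\<dots> = (\<Sum>j<m. of_real c * w j)"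
    by (subst sym) (simp add: row' flip: sum_distrib_right)
  also have "\<dots> = 0" using sum_w by (simp flip: sum_distrib_left)
  finally have sum_z: "(\<Sum>i<m. z i) = 0" .
  have shift: "b - (\<Sum>j<m. of_real (A i j) * u j) = (b - of_real c * \<mu>) - z i" for i
    by (simp add: z_def w_def algebra_simps sum_subtractf sum_distrib_left[symmetric] row')
  have "(\<Sum>i<m. (cmod (b - (\<Sum>j<m. of_real (A i j) * u j)))\<^sup>2) =
      real m * (cmod (b - of_real c * \<mu>))\<^sup>2 + (\<Sum>i<m. (cmod (z i))\<^sup>2)"
    by (simp only: shift sum_cmod2_diff_const[OF sum_z])
  moreover have "(\<Sum>i<m. (cmod (z i))\<^sup>2) \<le> (\<Sum>i<m. (cmod (w i))\<^sup>2)"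
    unfolding z_def by (rule contr)
  moreover have "(\<Sum>i<m. (cmod (u i))\<^sup>2) = real m * (cmod \<mu>)\<^sup>2 + (\<Sum>i<m. (cmod (w i))\<^sup>2)"
    using sum_cmod2_diff_const[OF sum_w, of "- \<mu>"] by (simp add: w_def norm_minus_commute)
  ultimately show ?thesis by simp
qed

text \<open>Split by the lowest digit, the kernel has diagonal blocks \<open>-B\<close> and constant
  off-diagonal blocks. Fluctuations only meet \<open>-B\<close>, a contraction by induction; the
  pair of means is acted on by the 2 by 2 matrix with diagonal \<open>-c\<close> and off-diagonal
  1/2, a contraction since \<open>\<bar>c\<bar> \<le> 1/2\<close>.\<close>

lemma alt_kernel_contraction:
  "(\<Sum>i<2 ^ L. (cmod (\<Sum>j<2 ^ L. of_real (alt_kernel L i j) * w j))\<^sup>2) \<le> (\<Sum>i<2 ^ L. (cmod (w i))\<^sup>2)"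
proof (induction L arbitrary: w)
  case (Suc L)
  define m where "m = (2 ^ L :: nat)"
  have m: "0 < m" by (simp add: m_def)
  obtain c where c: "\<bar>c\<bar> \<le> 1 / 2" "\<And>x. (\<Sum>y<m. alt_kernel L x y) = c"
    using sum_alt_kernel[of L] by (auto simp: m_def)
  define u v where "u k = w (2 * k)" and "v k = w (Suc (2 * k))" for k
  define \<mu> \<nu> where "\<mu> = (\<Sum>j<m. u j) / of_nat m" and "\<nu> = (\<Sum>j<m. v j) / of_nat m"
  \<comment> \<open>With this weight a constant block returns half the mean of the other half of
    \<open>w\<close>.\<close>
  have "1 / 2 ^ Suc L = (1 / (2 * of_nat m) :: complex)" by (simp add: m_def)
  then have even: "(\<Sum>j<2 * m. of_real (alt_kernel (Suc L) (2 * i) j) * w j) =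
      \<nu> / 2 - (\<Sum>j<m. of_real (alt_kernel L i j) * u j)"
    and odd: "(\<Sum>j<2 * m. of_real (alt_kernel (Suc L) (Suc (2 * i)) j) * w j) =
      \<mu> / 2 - (\<Sum>j<m. of_real (alt_kernel L i j) * v j)" for i
    by (simp_all add: sum_lessThan_double u_def v_def \<mu>_def \<nu>_def sum_negf
        mod2_eq_if sum_distrib_left[symmetric] sum_divide_distrib[symmetric])
  have split: "(\<Sum>i<m. (cmod (b - (\<Sum>j<m. of_real (alt_kernel L i j) * y j)))\<^sup>2) \<le>
      (\<Sum>i<m. (cmod (y i))\<^sup>2) + real m * (cmod (b - of_real c * ((\<Sum>j<m. y j) / of_nat m)))\<^sup>2
        - real m * (cmod ((\<Sum>j<m. y j) / of_nat m))\<^sup>2" for b y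
    using m alt_kernel_commute c(2) Suc.IH[folded m_def] by (rule sum_cmod2_mean_split)
  have half: "cmod (a / 2 - of_real c * b) \<le> (cmod a + cmod b) / 2" for a b
  proof -
    have "cmod (a / 2 - of_real c * b) \<le> cmod a / 2 + \<bar>c\<bar> * cmod b"
      using norm_triangle_ineq4[of "a / 2" "of_real c * b"] by (simp add: norm_mult norm_divide)
    also have "\<dots> \<le> cmod a / 2 + 1 / 2 * cmod b"
      using c(1) by (intro add_left_mono mult_right_mono) auto
    finally show ?thesis by simp
  qed
  have "(cmod (\<nu> / 2 - of_real c * \<mu>))\<^sup>2 \<le> ((cmod \<mu> + cmod \<nu>) / 2)\<^sup>2"
    using half[of \<nu> \<mu>] by (intro power_mono) (simp_all add: add.commute)
  moreover have "(cmod (\<mu> / 2 - of_real c * \<nu>))\<^sup>2 \<le> ((cmod \<mu> + cmod \<nu>) / 2)\<^sup>2"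
    using half by (intro power_mono) simp_all
  moreover have "2 * ((cmod \<mu> + cmod \<nu>) / 2)\<^sup>2 \<le> (cmod \<mu>)\<^sup>2 + (cmod \<nu>)\<^sup>2"
    using sum_squares_bound[of "cmod \<nu>" "cmod \<mu>"] by (simp add: power2_eq_square field_simps)
  ultimately have "(cmod (\<nu> / 2 - of_real c * \<mu>))\<^sup>2 + (cmod (\<mu> / 2 - of_real c * \<nu>))\<^sup>2
      \<le> (cmod \<mu>)\<^sup>2 + (cmod \<nu>)\<^sup>2"
    by linarith
  then have means: "real m * (cmod (\<nu> / 2 - of_real c * \<mu>))\<^sup>2 + real m * (cmod (\<mu> / 2 - of_real c * \<nu>))\<^sup>2
      \<le> real m * (cmod \<mu>)\<^sup>2 + real m * (cmod \<nu>)\<^sup>2"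
    by (simp add: mult_left_mono flip: distrib_left)
  have "(\<Sum>i<2 ^ Suc L. (cmod (\<Sum>j<2 ^ Suc L. of_real (alt_kernel (Suc L) i j) * w j))\<^sup>2) =
      (\<Sum>i<m. (cmod (\<nu> / 2 - (\<Sum>j<m. of_real (alt_kernel L i j) * u j)))\<^sup>2) +
      (\<Sum>i<m. (cmod (\<mu> / 2 - (\<Sum>j<m. of_real (alt_kernel L i j) * v j)))\<^sup>2)"
    unfolding power_Suc[of 2 L] m_def[symmetric]
    by (subst sum_lessThan_double) (simp only: even odd)
  also have "\<dots> \<le> (\<Sum>i<m. (cmod (u i))\<^sup>2) + (\<Sum>i<m. (cmod (v i))\<^sup>2)"
    using split[of "\<nu> / 2" u] split[of "\<mu> / 2" v] means by (simp only: \<mu>_def \<nu>_def)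
  also have "\<dots> = (\<Sum>i<2 ^ Suc L. (cmod (w i))\<^sup>2)"
    unfolding power_Suc[of 2 L] m_def[symmetric] sum_lessThan_double by (simp add: u_def v_def)
  finally show ?case .
qed simp

section \<open>Hoelder extension and the lower bound\<close>

text \<open>After division by \<open>s = a + b\<close> the summands lie in [0, 1], where raising to
  the power \<open>\<alpha>\<close> does not decrease them.\<close>

lemma powr_add_le:
  fixes a b :: real
  assumes "0 \<le> a" "0 \<le> b" "0 < \<alpha>" "\<alpha> \<le> 1"
  shows "(a + b) powr \<alpha> \<le> a powr \<alpha> + b powr \<alpha>"
proof (cases "a + b = 0")
  case True
  then show ?thesis using assms by simp
next
  case False
  define s where "s = a + b"
  have s: "0 < s" using False assms by (simp add: s_def)
  have "a / s \<le> (a / s) powr \<alpha>" "b / s \<le> (b / s) powr \<alpha>"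
    using powr_mono'[of \<alpha> 1 "a / s"] powr_mono'[of \<alpha> 1 "b / s"] assms s by (auto simp: s_def)
  then have "a / s + b / s \<le> a powr \<alpha> / s powr \<alpha> + b powr \<alpha> / s powr \<alpha>"
    using assms s by (simp add: powr_divide)
  moreover have "a / s + b / s = 1" using s by (simp add: s_def flip: add_divide_distrib)
  ultimately have "1 \<le> (a powr \<alpha> + b powr \<alpha>) / s powr \<alpha>"
    by (simp add: add_divide_distrib)
  then show ?thesis using s by (simp add: s_def le_divide_eq)
qed

text \<open>McShane's extension: the minimum of the cones
  \<open>v i + cmod (z - p i) powr \<alpha>\<close>. Subadditivity of the power makes each cone
  Hoelder with constant 1.\<close>

lemma holder_extension:
  fixes p :: "'i \<Rightarrow> complex" and v :: "'i \<Rightarrow> real"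
  assumes I: "finite I" "I \<noteq> {}" and \<alpha>: "0 < \<alpha>" "\<alpha> \<le> 1"
    and v: "\<And>i j. i \<in> I \<Longrightarrow> j \<in> I \<Longrightarrow> v i - v j \<le> cmod (p i - p j) powr \<alpha>"
  shows "\<exists>h. (\<forall>i\<in>I. h (p i) = v i) \<and> (\<forall>z w. \<bar>h z - h w\<bar> \<le> cmod (z - w) powr \<alpha>)"
proof -
  define h where "h z = Min ((\<lambda>i. v i + cmod (z - p i) powr \<alpha>) ` I)" for z
  have "h (p i) = v i" if i: "i \<in> I" for i
    unfolding h_def
  proof (rule Min_eqI)
    show "v i \<in> (\<lambda>j. v j + cmod (p i - p j) powr \<alpha>) ` I"
      using i by (intro image_eqI[of _ _ i]) auto
  qed (use I i v in \<open>auto simp: algebra_simps\<close>)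
  moreover have "h z \<le> h w + cmod (z - w) powr \<alpha>" for z w
  proof -
    have "h w \<in> (\<lambda>i. v i + cmod (w - p i) powr \<alpha>) ` I"
      unfolding h_def using I by (intro Min_in) auto
    then obtain i where i: "i \<in> I" "h w = v i + cmod (w - p i) powr \<alpha>" by auto
    have "h z \<le> v i + cmod (z - p i) powr \<alpha>"
      unfolding h_def using I i by (intro Min_le) auto
    also have "cmod (z - p i) powr \<alpha> \<le> (cmod (z - w) + cmod (w - p i)) powr \<alpha>"
      using \<alpha> norm_triangle_ineq[of "z - w" "w - p i"] by (intro powr_mono2) auto
    also have "\<dots> \<le> cmod (z - w) powr \<alpha> + cmod (w - p i) powr \<alpha>"
      using \<alpha> by (intro powr_add_le) auto
    finally show ?thesis using i by simp
  qed
  then have "\<bar>h z - h w\<bar> \<le> cmod (z - w) powr \<alpha>" for z w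
    by (metis abs_diff_le_iff add.commute diff_le_eq norm_minus_commute)
  ultimately show ?thesis by blast
qed

text \<open>Makes the denominator of the Hoelder quotient positive.\<close>

lemma op_norm_diff_pos:
  assumes S: "S \<in> bounded_ops (cspace n)" and T: "T \<in> bounded_ops (cspace n)" and "S \<noteq> T"
  shows "0 < op_norm (cspace n) (op_diff (cspace n) S T)"
proof (rule ccontr)
  assume neg: "\<not> ?thesis"
  have "S x = T x" for x
  proof (cases "x \<in> cvec n")
    case True
    then have cl: "S x \<in> cvec n" "T x \<in> cvec n"
      using S T bounded_ops_cspaceD(1) by blast+
    have "cnorm n (op_diff (cspace n) S T x) \<le> op_norm (cspace n) (op_diff (cspace n) S T) * cnorm n x"
      using S T True by (intro op_norm_cspace_upper bounded_ops_diff)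
    also have "\<dots> \<le> 0" using neg by (simp add: mult_nonpos_nonneg)
    finally have "cnorm n (\<lambda>i. S x i - T x i) = 0"
      using True cl by (simp add: op_diff_def order_antisym)
    then have "(\<lambda>i. S x i - T x i) = (\<lambda>i. 0)" using cl cnorm_eq_0 by blast
    then show ?thesis by (simp add: fun_eq_iff)
  next
    case False
    then show ?thesis using bounded_ops_cspaceD(2)[OF S] bounded_ops_cspaceD(2)[OF T] by simp
  qed
  with \<open>S \<noteq> T\<close> show False by blast
qed

lemma (in skew_hermitian) commutator_component:
  assumes "i < n"
  shows "e i * R y i - R (\<lambda>i. e i * y i) i = (\<Sum>j<n. (e i - e j) * r i j * y j)"
  using assms by (simp add: mat_app_def sum_distrib_left sum_subtractf algebra_simps)

section \<open>The dyadic pair of operators\<close>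

locale dyadic =
  fixes L :: nat
begin

definition n :: nat where "n = 2 ^ L"

text \<open>Small enough that \<open>R\<close> is a contraction, as
  \<open>n^2 * 4^L * t = 1\<close>, yet only exponentially small in \<open>L\<close>, so that
  \<open>t powr (1 - \<alpha>)\<close> is bounded below when
  \<open>L * (1 - \<alpha>) \<le> 1\<close>.\<close>

definition t :: real where "t = 1 / 16 ^ L"

text \<open>The solution of \<open>[\<lambda>, R] = t B\<close> with zero diagonal, where
  \<open>0 / 0 = 0\<close>.\<close>

definition r :: "nat \<Rightarrow> nat \<Rightarrow> complex" where
  "r i j = of_real (t * alt_kernel L i j / (cantor_pt L i - cantor_pt L j))"

lemma t_pos: "0 < t"
  by (simp add: t_def)

sublocale skew_hermitian n r
proof
  fix i j assume "i < n" "j < n"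
  have "t * alt_kernel L j i / (cantor_pt L j - cantor_pt L i) =
      - (t * alt_kernel L i j / (cantor_pt L i - cantor_pt L j))"
    by (simp add: minus_divide_right alt_kernel_commute[of L j i])
  then show "r j i = - cnj (r i j)"
    by (simp only: r_def complex_cnj_complex_of_real of_real_minus)
qed

lemma cmod_r_le:
  assumes "i < n" "j < n"
  shows "cmod (r i j) \<le> t * 4 ^ L"
proof (cases "i = j")
  case True
  then show ?thesis using t_pos by (simp add: r_def)
next
  case False
  let ?d = "cantor_pt L i - cantor_pt L j"
  have d: "2 / 3 / 4 ^ L \<le> \<bar>?d\<bar>"
    using cantor_pt_separation[of i L j] assms False by (simp add: n_def)
  \<comment> \<open>The bound 1/2 is relaxed to match the constant of the separation
    estimate.\<close>
  have "\<bar>alt_kernel L i j\<bar> \<le> 2 / 3"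
    using abs_alt_kernel_le[of L i j] by linarith
  also have "2 / 3 \<le> 4 ^ L * \<bar>?d\<bar>" using d by (simp add: field_simps)
  finally have "\<bar>alt_kernel L i j\<bar> / \<bar>?d\<bar> \<le> 4 ^ L"
    using d by (intro divide_le_eq[THEN iffD2]) auto
  then have "t * (\<bar>alt_kernel L i j\<bar> / \<bar>?d\<bar>) \<le> t * 4 ^ L"
    using t_pos by (intro mult_left_mono) auto
  then show ?thesis using t_pos by (simp only: r_def norm_of_real) (simp add: abs_mult)
qed

lemma cnorm_R_le: "cnorm n (R y) \<le> cnorm n y"
proof -
  have "(real n)\<^sup>2 * (t * 4 ^ L) = 1"
    by (simp add: n_def t_def power2_eq_square flip: power_mult_distrib)
  then show ?thesis
    using cnorm_mat_app_le[of n r "t * 4 ^ L" y] cmod_r_le by simp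
qed

lemma commutator_cantor_le:
  "cnorm n (\<lambda>i. of_real (cantor_pt L i) * R y i - R (\<lambda>i. of_real (cantor_pt L i) * y i) i)
    \<le> t * cnorm n y"
proof -
  let ?d = "\<lambda>i. complex_of_real (cantor_pt L i)"
  have "?d i * R y i - R (\<lambda>i. ?d i * y i) i = of_real t * (\<Sum>j<n. of_real (alt_kernel L i j) * y j)"
    if i: "i < n" for i
  proof -
    have entry: "(?d i - ?d j) * r i j = of_real t * of_real (alt_kernel L i j)" if "j < n" for j
    proof (cases "i = j")
      case False
      have "0 < 2 / 3 / (4::real) ^ L" by simp
      also have "\<dots> \<le> \<bar>cantor_pt L i - cantor_pt L j\<bar>"
        using cantor_pt_separation[of i L j] i that False by (simp add: n_def)
      finally have "cantor_pt L i \<noteq> cantor_pt L j" by auto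
      then show ?thesis by (simp add: r_def)
    qed simp
    have "?d i * R y i - R (\<lambda>i. ?d i * y i) i = (\<Sum>j<n. (?d i - ?d j) * r i j * y j)"
      by (rule commutator_component[OF i])
    also have "\<dots> = (\<Sum>j<n. of_real t * of_real (alt_kernel L i j) * y j)"
      by (intro sum.cong refl) (simp only: lessThan_iff entry)
    finally show ?thesis by (simp add: sum_distrib_left mult.assoc)
  qed
  then have "cnorm n (\<lambda>i. ?d i * R y i - R (\<lambda>i. ?d i * y i) i) =
      t * L2_set (\<lambda>i. cmod (\<Sum>j<n. of_real (alt_kernel L i j) * y j)) {..<n}"
    using t_pos by (simp add: cnorm_def L2_set_right_distrib norm_mult cong: L2_set_cong_simp)
  also have "\<dots> \<le> t * cnorm n y"
    using t_pos alt_kernel_contraction[of L y]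
    by (intro mult_left_mono) (simp_all add: cnorm_def L2_set_def n_def)
  finally show ?thesis .
qed

text \<open>Pairing with the all-ones vector adds up all entries of the commutator. Their signs
  agree, so the sum is controlled by the absolute row sums \<open>L / 2\<close> of the kernel, and
  Cauchy-Schwarz gives the norm.\<close>

lemma commutator_alt_ge:
  assumes e: "\<And>i. i < n \<Longrightarrow> e i = of_real (alt_pt L i / 2)"
  defines "y \<equiv> (\<lambda>i. if i < n then 1 else 0)"
  shows "t * real L / 8 * cnorm n y \<le> cnorm n (\<lambda>i. e i * R y i - R (\<lambda>i. e i * y i) i)"
proof -
  define u where "u = (\<lambda>i. e i * R y i - R (\<lambda>i. e i * y i) i)"
  define g where "g i j = (alt_pt L i / 2 - alt_pt L j / 2) *
    (t * alt_kernel L i j / (cantor_pt L i - cantor_pt L j))" for i j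
  have "cinner n y y = of_nat n" by (simp add: cinner_def y_def)
  then have norm_y: "cnorm n y * cnorm n y = real n"
    using cinner_self[of n y] by (metis of_real_eq_iff of_real_of_nat_eq power2_eq_square)
  have "cinner n u y = (\<Sum>i<n. u i)" by (simp add: cinner_def y_def)
  also have "\<dots> = (\<Sum>i<n. \<Sum>j<n. of_real (g i j))"
  proof (intro sum.cong refl)
    fix i assume "i \<in> {..<n}"
    then have i: "i < n" by simp
    have "u i = (\<Sum>j<n. (e i - e j) * r i j * y j)"
      unfolding u_def by (rule commutator_component[OF i])
    also have "\<dots> = (\<Sum>j<n. of_real (g i j))"
      by (intro sum.cong refl) (simp add: e i y_def g_def r_def)
    finally show "u i = (\<Sum>j<n. of_real (g i j))" .
  qed
  finally have u_eq: "cinner n u y = of_real (\<Sum>i<n. \<Sum>j<n. g i j)" by simp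
  \<comment> \<open>One factor 1/2 comes from halving \<open>alt_pt\<close>, the other from the
    divided differences.\<close>
  have "t / 4 * \<bar>alt_kernel L i j\<bar> \<le> g i j" if "i < n" "j < n" for i j
  proof (cases "i = j")
    case False
    then have "\<bar>alt_kernel L i j\<bar> / 2 \<le>
        alt_kernel L i j * ((alt_pt L i - alt_pt L j) / (cantor_pt L i - cantor_pt L j))"
      using cantor_pt_separation[of i L j] that by (simp add: n_def)
    then have "t / 2 * (\<bar>alt_kernel L i j\<bar> / 2) \<le> t / 2 *
        (alt_kernel L i j * ((alt_pt L i - alt_pt L j) / (cantor_pt L i - cantor_pt L j)))"
      using t_pos by (intro mult_left_mono) auto
    then show ?thesis by (simp add: g_def algebra_simps diff_divide_distrib)
  qed (simp add: g_def)
  then have "(\<Sum>i<n. \<Sum>j<n. t / 4 * \<bar>alt_kernel L i j\<bar>) \<le> (\<Sum>i<n. \<Sum>j<n. g i j)"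
    by (intro sum_mono) auto
  moreover have "(\<Sum>j<n. t / 4 * \<bar>alt_kernel L i j\<bar>) = t * real L / 8" for i
    by (subst sum_distrib_left[symmetric]) (simp add: sum_abs_alt_kernel n_def)
  ultimately have "(\<Sum>i<n. t * real L / 8) \<le> (\<Sum>i<n. \<Sum>j<n. g i j)" by (simp only:)
  then have "t * real L / 8 * real n \<le> (\<Sum>i<n. \<Sum>j<n. g i j)" by (simp add: mult.commute)
  then have "t * real L / 8 * real n \<le> cmod (cinner n u y)"
    unfolding u_eq norm_of_real by linarith
  also have "\<dots> \<le> cnorm n u * cnorm n y" by (rule cmod_cinner_le)
  finally have "(t * real L / 8 * cnorm n y) * cnorm n y \<le> cnorm n u * cnorm n y"
    by (simp add: norm_y mult.assoc)
  moreover have "cnorm n y \<noteq> 0" using norm_y by (auto simp: n_def)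
  then have "0 < cnorm n y" by (simp add: order_less_le)
  ultimately show ?thesis by (simp add: u_def)
qed

definition N1 where "N1 = ident.conj_diag (\<lambda>i. of_real (cantor_pt L i))"
definition N2 where "N2 = cayley.conj_diag (\<lambda>i. of_real (cantor_pt L i))"

lemma op_norm_N_diff_le: "op_norm (cspace n) (op_diff (cspace n) N1 N2) \<le> 2 * t"
  unfolding N1_def N2_def
  using commutator_cantor_le t_pos by (intro op_norm_diff_cayley_le) auto

text \<open>\<open>f\<close> acts on the eigenvalues, so its values at \<open>N1\<close> and
  \<open>N2\<close> are again a diagonal operator and its conjugate by the same unitary.\<close>

lemma op_norm_apply_diff_ge:
  assumes f: "\<And>i. i < n \<Longrightarrow> f (of_real (cantor_pt L i)) = of_real (alt_pt L i / 2)"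
  shows "t * real L / 16 \<le>
    op_norm (cspace n) (op_diff (cspace n) (op_apply (cspace n) f N1) (op_apply (cspace n) f N2))"
    (is "_ \<le> ?A")
proof -
  define y :: "nat \<Rightarrow> complex" where "y = (\<lambda>i. if i < n then 1 else 0)"
  have y: "y \<in> cvec n" by (simp add: y_def cvec_def)
  have "0 < n" by (simp add: n_def)
  then have "0 < cnorm n y" using norm_component_le[of 0 n y] by (simp add: y_def)
  moreover have "t * real L / 8 * cnorm n y \<le> ?A * (2 * cnorm n y)"
    unfolding N1_def N2_def ident.op_apply_conj_diag cayley.op_apply_conj_diag
  proof (rule order_trans[OF _ op_norm_diff_cayley_ge[OF cnorm_R_le y]])
    let ?e = "\<lambda>i. f (complex_of_real (cantor_pt L i))"
    show "t * real L / 8 * cnorm n y \<le> cnorm n (\<lambda>i. ?e i * R y i - R (\<lambda>i. ?e i * y i) i)"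
      unfolding y_def by (rule commutator_alt_ge) (rule f)
  qed
  ultimately show ?thesis by (simp add: mult.assoc[symmetric])
qed

lemma op_holder_const_ge:
  assumes \<alpha>: "0 < \<alpha>" "\<alpha> < 1" and L: "1 \<le> L" "real L * (1 - \<alpha>) \<le> 1"
  shows "ennreal (real L / 512) \<le> op_holder_const \<alpha>"
proof -
  define pt where "pt i = complex_of_real (cantor_pt L i)" for i
  have "alt_pt L i / 2 - alt_pt L j / 2 \<le> cmod (pt i - pt j) powr \<alpha>"
    if "i \<in> {..<n}" "j \<in> {..<n}" for i j
  proof (cases "i = j")
    case False
    let ?d = "\<bar>cantor_pt L i - cantor_pt L j\<bar>"
    have "\<bar>alt_pt L i - alt_pt L j\<bar> \<le> 2 * ?d"
      using cantor_pt_separation[of i L j] that False by (auto simp: n_def)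
    then have "alt_pt L i / 2 - alt_pt L j / 2 \<le> ?d" by argo
    \<comment> \<open>The points have mutual distance at most 1/3, hence below 1, so the Lipschitz
      bound implies the Hoelder bound.\<close>
    also have "\<dots> \<le> ?d powr \<alpha>"
      using powr_mono'[of \<alpha> 1 ?d] \<alpha> abs_cantor_pt_diff_le[of L i j] by simp
    finally show ?thesis by (simp add: pt_def flip: of_real_diff)
  qed simp
  moreover have "0 \<in> {..<n}" by (simp add: n_def)
  then have "{..<n} \<noteq> {}" by blast
  ultimately obtain h where h: "\<forall>i\<in>{..<n}. h (pt i) = alt_pt L i / 2"
    "\<forall>z w. \<bar>h z - h w\<bar> \<le> cmod (z - w) powr \<alpha>"
    using holder_extension[of "{..<n}" \<alpha> "\<lambda>i. alt_pt L i / 2" pt] \<alpha> by auto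
  define f where "f z = complex_of_real (h z)" for z
  have "holder_seminorm \<alpha> f \<le> 1"
    unfolding holder_seminorm_def
  proof (rule SUP_least, clarify)
    fix z w :: complex assume "z \<noteq> w"
    then have "cmod (f z - f w) / cmod (z - w) powr \<alpha> \<le> 1"
      using h(2) by (simp add: f_def divide_le_eq flip: of_real_diff)
    then show "ennreal (cmod (f z - f w) / cmod (z - w) powr \<alpha>) \<le> 1"
      by (simp add: ennreal_le_1)
  qed
  then have f: "f \<in> {f \<in> holder_class \<alpha>. holder_seminorm \<alpha> f \<le> 1}"
    by (auto simp: holder_class_def intro: order_le_less_trans)
  let ?H = "cspace n"
  define A where "A = op_norm ?H (op_diff ?H (op_apply ?H f N1) (op_apply ?H f N2))"
  define \<delta> where "\<delta> = op_norm ?H (op_diff ?H N1 N2)"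
  have A: "t * real L / 16 \<le> A"
    unfolding A_def
  proof (rule op_norm_apply_diff_ge)
    fix i assume "i < n"
    then have "h (pt i) = alt_pt L i / 2" using h(1) by blast
    then show "f (of_real (cantor_pt L i)) = of_real (alt_pt L i / 2)"
      unfolding f_def pt_def by (rule arg_cong)
  qed
  have \<delta>: "\<delta> \<le> 2 * t"
    unfolding \<delta>_def by (rule op_norm_N_diff_le)
  have normal: "N1 \<in> normal_ops ?H" "N2 \<in> normal_ops ?H"
    unfolding N1_def N2_def by (rule ident.conj_diag_normal cayley.conj_diag_normal)+
  \<comment> \<open>Equality would give \<open>A \<le> 0\<close>, against the lower bound for
    \<open>A\<close>, which is positive because \<open>1 \<le> L\<close>.\<close>
  have "N1 \<noteq> N2"
  proof
    assume "N1 = N2"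
    moreover have "op_apply ?H f N2 \<in> bounded_ops ?H"
      unfolding N2_def cayley.op_apply_conj_diag by (rule cayley.conj_diag_bounded)
    ultimately have "A \<le> 0"
      unfolding A_def by (intro op_norm_cspace_le)
        (auto simp: op_diff_def dest: bounded_ops_cspaceD(1))
    moreover have "0 < t * real L / 16" using t_pos L by simp
    ultimately show False using A by linarith
  qed
  then have "0 < \<delta>"
    unfolding \<delta>_def using normal by (intro op_norm_diff_pos) (auto simp: normal_ops_def)
  have "(2 * t) powr \<alpha> \<le> 2 * t powr \<alpha>"
    using \<alpha> t_pos powr_mono[of \<alpha> 1 2] by (simp add: powr_mult)
  have "\<delta> powr \<alpha> \<le> (2 * t) powr \<alpha>"
    using \<open>0 < \<delta>\<close> \<delta> \<alpha> by (intro powr_mono2) auto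
  also have "\<dots> \<le> 2 * t powr \<alpha>" by fact
  finally have "\<delta> powr \<alpha> \<le> 2 * t powr \<alpha>" .
  \<comment> \<open>The exponent of 16 is \<open>- (L * (1 - \<alpha>))\<close>, which is at least
    -1.\<close>
  have "1 / 16 \<le> t powr (1 - \<alpha>)"
  proof -
    have "t = 16 powr (- real L)" by (simp add: t_def powr_minus powr_realpow divide_inverse)
    then have "t powr (1 - \<alpha>) = 16 powr (- (real L * (1 - \<alpha>)))" by (simp add: powr_powr)
    moreover have "(16::real) powr (- 1) \<le> 16 powr (- (real L * (1 - \<alpha>)))"
      using L by (intro powr_mono) auto
    ultimately show ?thesis by (simp add: powr_minus_divide)
  qed
  moreover have "t powr \<alpha> * t powr (1 - \<alpha>) = t" using t_pos by (simp flip: powr_add)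
  ultimately have "t powr \<alpha> * (1 / 16) \<le> t"
    by (metis mult_left_mono powr_ge_zero)
  \<comment> \<open>512 = 16 * 2 * 16: the lower bound for \<open>A\<close>, the factor in the bound
    for \<open>\<delta> powr \<alpha>\<close>, and the loss in
    \<open>t powr (1 - \<alpha>)\<close>.\<close>
  have "real L / 512 * \<delta> powr \<alpha> \<le> real L / 512 * (2 * t powr \<alpha>)"
    by (intro mult_left_mono) (auto intro: \<open>\<delta> powr \<alpha> \<le> 2 * t powr \<alpha>\<close>)
  also have "\<dots> = real L / 16 * (t powr \<alpha> * (1 / 16))" by simp
  also have "\<dots> \<le> real L / 16 * t"
    by (intro mult_left_mono) (use \<open>t powr \<alpha> * (1 / 16) \<le> t\<close> in auto)
  also have "\<dots> \<le> A" using A by (simp add: mult.commute)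
  finally have "real L / 512 \<le> A / \<delta> powr \<alpha>"
    using \<open>0 < \<delta>\<close> by (simp add: le_divide_eq)
  then have "ennreal (real L / 512) \<le> ennreal (A / \<delta> powr \<alpha>)" by (rule ennreal_leI)
  also have "\<dots> \<le> op_holder_seminorm \<alpha> f"
    unfolding op_holder_seminorm_def A_def \<delta>_def
    by (rule SUP_upper2[of "(?H, N1, N2)"])
       (use separable_hilbert_space_cspace normal \<open>N1 \<noteq> N2\<close> in auto)
  also have "\<dots> \<le> op_holder_const \<alpha>"
    unfolding op_holder_const_def using f by (rule SUP_upper)
  finally show ?thesis .
qed

end

theorem theorem7p1:
  shows "\<exists>C>0. \<forall>\<alpha>. 0 < \<alpha> \<and> \<alpha> < 1 \<longrightarrow>
    op_holder_const \<alpha> \<ge> ennreal (C * (1 - \<alpha>) powr (- (1 / 2)))"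
proof (intro exI[of _ "1 / 1024 :: real"] conjI allI impI)
  fix \<alpha> :: real assume \<alpha>: "0 < \<alpha> \<and> \<alpha> < 1"
  \<comment> \<open>The largest integer with \<open>L * (1 - \<alpha>) \<le> 1\<close>. Since
    \<open>L \<ge> 1\<close>, also \<open>1 / (1 - \<alpha>) < L + 1 \<le> 2 * L\<close>, which
    turns 512 into 1024.\<close>
  define L where "L = nat \<lfloor>1 / (1 - \<alpha>)\<rfloor>"
  have "1 \<le> 1 / (1 - \<alpha>)" using \<alpha> by (simp add: le_divide_eq)
  then have L: "1 \<le> L" "real L \<le> 1 / (1 - \<alpha>)" "1 / (1 - \<alpha>) < real L + 1"
    unfolding L_def by linarith+
  \<comment> \<open>The base lies below 1, so the exponent -1 gives the larger value; this is where
    the stronger bound is weakened to the stated one.\<close>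
  have "(1 - \<alpha>) powr (- (1 / 2)) \<le> (1 - \<alpha>) powr (- 1)"
    using \<alpha> by (intro powr_mono') auto
  also have "\<dots> = 1 / (1 - \<alpha>)" using \<alpha> by (simp add: powr_minus_divide)
  also have "\<dots> \<le> 2 * real L" using L by linarith
  finally have "ennreal (1 / 1024 * (1 - \<alpha>) powr (- (1 / 2))) \<le> ennreal (real L / 512)"
    by (intro ennreal_leI) simp
  also have "\<dots> \<le> op_holder_const \<alpha>"
    using \<alpha> L by (intro dyadic.op_holder_const_ge) (auto simp: field_simps)
  finally show "ennreal (1 / 1024 * (1 - \<alpha>) powr (- (1 / 2))) \<le> op_holder_const \<alpha>" .
qed simp

end
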